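(* Let $n\ge1$ and $v,w\in\mathfrak{S}_n$. For $J\subseteq\mathrm{GDes}(v)$ let $C_J(v,w)$ be the set of $\zeta\in\mathfrak{S}_n$ with $\mathrm{Des}(\zeta)\subseteq J$ such that: (i) $v_J\zeta^{-1}\le w$; (ii) if $v'\in\mathfrak{S}_n$, $v\le v'$ and $v'_J\zeta^{-1}\le w$, then $v'=v$; (iii) if $R$ is a set with $\mathrm{Des}(\zeta)\subseteq R\subseteq J$ and $v_R\zeta^{-1}\le w$, then $R=J$. Let $\kappa(v,w)=\#C_{\mathrm{GDes}(v)}(v,w)$. Then the antipode $S$ of $\mathfrak{S}Sym$ satisfies $$S(\mathcal{M}_v)=(-1)^{\#\mathrm{GDes}(v)+1}\sum_{w\in\mathfrak{S}_n}\kappa(v,w)\,\mathcal{M}_w .$$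
   Context: Permutations in one-line notation, product is composition. $\mathrm{Des}(x)=\{p\in[n-1]:x_p>x_{p+1}\}$; $\mathrm{GDes}(x)=\{p\in[n-1]: x_i>x_j \text{ for all } i\le p<j\}$. $\mathrm{st}(a_1,\ldots,a_m)\in\mathfrak{S}_m$ is the permutation with the same relative order as the distinct integers $a_i$. For $x\in\mathfrak{S}_a,y\in\mathfrak{S}_b$, $x\times y\in\mathfrak{S}_{a+b}$ has $(x\times y)(i)=x_i$ ($i\le a$), $(x\times y)(a+j)=a+y_j$. For $v\in\mathfrak{S}_n$, $J=\{p_1<\cdots<p_k\}\subseteq[n-1]$: $v_J=\mathrm{st}(v_1..v_{p_1})\times\mathrm{st}(v_{p_1+1}..v_{p_2})\times\cdots\times\mathrm{st}(v_{p_k+1}..v_n)$, $v_\emptyset=v$. Weak order: $u\le v$ iff $\mathrm{Inv}(u)\subseteq\mathrm{Inv}(v)$, $\mathrm{Inv}(u)=\{(i,j):i<j,u_i>u_j\}$, Möbius function $\mu$. $\mathfrak{S}Sym$ is the graded connected Hopf algebra over $\mathbb{Q}$ with basis $\{\mathcal{F}_u\}$, product $\mathcal{F}_u\cdot\mathcal{F}_v=\sum_{\zeta}\mathcal{F}_{(u\times v)\zeta^{-1}}$ over $\zeta\in\mathfrak{S}_{p+q}$ increasing on $[1,p]$ and on $[p+1,p+q]$, coproduct $\Delta(\mathcal{F}_u)=\sum_{p=0}^n\mathcal{F}_{\mathrm{st}(u_1..u_p)}\otimes\mathcal{F}_{\mathrm{st}(u_{p+1}..u_n)}$. Monomial basis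 $\mathcal{M}_u=\sum_{v\ge u}\mu(u,v)\mathcal{F}_v$. *)

theory Defs
  imports Complex_Main
begin

text \<open>Permutations of [n] are represented in one-line notation as lists of naturals
  whose set of entries is {1..n}.  Positions are 1-based via nth1.\<close>

definition nth1 :: "nat list \<Rightarrow> nat \<Rightarrow> nat" where
  "nth1 x i = x ! (i - 1)"

definition is_perm :: "nat list \<Rightarrow> bool" where
  "is_perm x \<longleftrightarrow> distinct x \<and> set x = {1..length x}"

definition perms :: "nat \<Rightarrow> nat list set" where
  "perms n = {x. length x = n \<and> is_perm x}"

definition Des :: "nat list \<Rightarrow> nat set" where
  "Des x = {p. 1 \<le> p \<and> p < length x \<and> nth1 x p > nth1 x (p + 1)}"

definition GDes :: "nat list \<Rightarrow> nat set" where
  "GDes x = {p. 1 \<le> p \<and> p < length x \<and>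
     (\<forall>i j. 1 \<le> i \<and> i \<le> p \<and> p < j \<and> j \<le> length x \<longrightarrow> nth1 x i > nth1 x j)}"

definition st :: "nat list \<Rightarrow> nat list" where
  "st xs = map (\<lambda>a. card {b \<in> set xs. b \<le> a}) xs"

definition cross :: "nat list \<Rightarrow> nat list \<Rightarrow> nat list" where
  "cross x y = x @ map (\<lambda>j. length x + j) y"

definition compose :: "nat list \<Rightarrow> nat list \<Rightarrow> nat list" where
  "compose x y = map (\<lambda>i. nth1 x i) y"

definition perm_inv :: "nat list \<Rightarrow> nat list" where
  "perm_inv x = map (\<lambda>j. Suc (LEAST i. i < length x \<and> x ! i = j)) [1..<Suc (length x)]"

fun blocks :: "nat list \<Rightarrow> nat list \<Rightarrow> nat list list" where
  "blocks [] v = [v]"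
| "blocks (p # ps) v = take p v # blocks (map (\<lambda>q. q - p) ps) (drop p v)"

definition parab :: "nat list \<Rightarrow> nat set \<Rightarrow> nat list" where
  "parab v J = foldl cross [] (map st (blocks (sorted_list_of_set J) v))"

definition Inv :: "nat list \<Rightarrow> (nat \<times> nat) set" where
  "Inv x = {(i, j). 1 \<le> i \<and> i < j \<and> j \<le> length x \<and> nth1 x i > nth1 x j}"

definition weak_le :: "nat list \<Rightarrow> nat list \<Rightarrow> bool" where
  "weak_le u v \<longleftrightarrow> is_perm u \<and> is_perm v \<and> length u = length v \<and> Inv u \<subseteq> Inv v"

text \<open>Moebius function of the weak order (unique solution of the defining recursion;
  the intervals are finite and the order is well-founded)\<close>
definition mu :: "nat list \<Rightarrow> nat list \<Rightarrow> rat" where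
  "mu = (THE f. \<forall>u v. f u v =
     (if weak_le u v then
        (if u = v then 1 else - (\<Sum>z\<in>{z. weak_le u z \<and> weak_le z v \<and> z \<noteq> v}. f u z))
      else 0))"

text \<open>Elements of SSym: finitely supported coefficient functions on the basis F_u\<close>
type_synonym ssym = "nat list \<Rightarrow> rat"

definition supp :: "ssym \<Rightarrow> nat list set" where
  "supp a = {u. a u \<noteq> 0}"

definition F :: "nat list \<Rightarrow> ssym" where
  "F u = (\<lambda>x. if x = u then 1 else 0)"

definition prodF :: "nat list \<Rightarrow> nat list \<Rightarrow> ssym" where
  "prodF u v = (\<lambda>x. of_nat (card {\<zeta> \<in> perms (length u + length v).
      (\<forall>i j. 1 \<le> i \<and> i < j \<and> j \<le> length u \<longrightarrow> nth1 \<zeta> i < nth1 \<zeta> j) \<and>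
      (\<forall>i j. length u + 1 \<le> i \<and> i < j \<and> j \<le> length u + length v \<longrightarrow> nth1 \<zeta> i < nth1 \<zeta> j) \<and>
      compose (cross u v) (perm_inv \<zeta>) = x}))"

definition mult :: "ssym \<Rightarrow> ssym \<Rightarrow> ssym" where
  "mult a b = (\<lambda>x. \<Sum>u\<in>supp a. \<Sum>v\<in>supp b. a u * b v * prodF u v x)"

text \<open>Antipode on basis elements: the unique map with m(S \<otimes> id)\<Delta> = \<eta>\<epsilon>, i.e.
  S(F_[]) = F_[] and for n \<ge> 1, sum_{p=0}^{n} S(F_{st(u_1..u_p)}) F_{st(u_{p+1}..u_n)} = 0.\<close>
function antiF :: "nat list \<Rightarrow> ssym" where
  "antiF u = (if u = [] then F []
     else (\<lambda>x. - (\<Sum>p<length u. mult (antiF (st (take p u))) (F (st (drop p u))) x)))"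
  by auto
termination
  by (relation "measure length") (auto simp: st_def)

definition antipode :: "ssym \<Rightarrow> ssym" where
  "antipode a = (\<lambda>x. \<Sum>u\<in>supp a. a u * antiF u x)"

definition M :: "nat list \<Rightarrow> ssym" where
  "M u = (\<lambda>x. if weak_le u x then mu u x else 0)"

definition C_set :: "nat set \<Rightarrow> nat list \<Rightarrow> nat list \<Rightarrow> nat list set" where
  "C_set J v w = {\<zeta> \<in> perms (length v). Des \<zeta> \<subseteq> J \<and>
      weak_le (compose (parab v J) (perm_inv \<zeta>)) w \<and>
      (\<forall>v' \<in> perms (length v). weak_le v v' \<and> weak_le (compose (parab v' J) (perm_inv \<zeta>)) w \<longrightarrow> v' = v) \<and>
      (\<forall>R. Des \<zeta> \<subseteq> R \<and> R \<subseteq> J \<and> weak_le (compose (parab v R) (perm_inv \<zeta>)) w \<longrightarrow> R = J)}"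

definition kappa :: "nat list \<Rightarrow> nat list \<Rightarrow> nat" where
  "kappa v w = card (C_set (GDes v) v w)"

end

theory Submission
  imports Defs
begin

text \<open>Unfolding the recursion for the antipode expresses the coefficient of $F_x$ in $S(F_u)$ as the
  sum of $(-1)^{|J|+1}$ over the pairs $(J, \zeta)$ with $\mathrm{Des}(\zeta) \subseteq J$ and
  $u_J \zeta^{-1} = x$ (the blocks are split off from the right, so $p$ in the recursion is
  $\max J$). Since $F_x = \sum_{w \ge x} M_w$, the coefficient of $M_w$ in $S(F_u)$ is the same sum
  over $u_J \zeta^{-1} \le w$. By Moebius inversion it remains to see that this equals the sum of
  $(-1)^{|\mathrm{GDes}(v)|+1} \kappa(v,w)$ over $v \ge u$.

  Put $y = w\zeta$. If $\mathrm{Des}(\zeta) \subseteq J$, then $u_J \zeta^{-1} \le w$ holds iff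
  $\zeta^{-1} \le w$ and on every $J$-block the inversions of $u$ are inversions of $y$. Given
  $\zeta^{-1} \le w$, conditions (i) and (ii) for $J \subseteq \mathrm{GDes}(v)$ say that $v$ and $y$ have
  the same relative order on every $J$-block. For fixed $v$ and $\zeta$ the sets $J$ between
  $\mathrm{Des}(\zeta)$ and $\mathrm{GDes}(v)$ with this property form an interval with top element
  $\mathrm{GDes}(v)$ (or no such $J$ exists), so their alternating sum is
  $(-1)^{|\mathrm{GDes}(v)|}$ times the indicator of (iii). For fixed $J$ and $\zeta$
  there is exactly one $v$ with $J \subseteq \mathrm{GDes}(v)$ that agrees with $y$ on the $J$-blocks, and
  it is the largest permutation whose inversions inside $J$-blocks are inversions of $y$; this
  matches the two sums.\<close>

section \<open>Permutations in one-line notation\<close>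

lemma nth1_eqI:
  assumes "length x = n" "length y = n" "\<And>i. 1 \<le> i \<Longrightarrow> i \<le> n \<Longrightarrow> nth1 x i = nth1 y i"
  shows "x = y"
proof (rule nth_equalityI)
  fix i assume "i < length x"
  with assms(1,2) assms(3)[of "Suc i"] show "x ! i = y ! i" by (simp add: nth1_def)
qed (use assms in simp)

lemma distinct_iff_inj_on_nth1: "distinct x \<longleftrightarrow> inj_on (nth1 x) {1..length x}"
proof -
  have "{1..length x} = Suc ` {..<length x}"
    by (simp add: image_Suc_lessThan)
  then have "inj_on (nth1 x) {1..length x} \<longleftrightarrow> inj_on (nth1 x \<circ> Suc) {..<length x}"
    by (simp add: comp_inj_on_iff[symmetric])
  also have "nth1 x \<circ> Suc = (!) x" by (auto simp: nth1_def)
  finally show ?thesis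
    by (simp add: distinct_conv_nth inj_on_def) blast
qed

lemma set_eq_nth1_image: "set x = nth1 x ` {1..length x}"
proof -
  have "{1..length x} = Suc ` {..<length x}"
    by (simp add: image_Suc_lessThan)
  then show ?thesis
    by (auto simp: set_conv_nth nth1_def image_image)
qed

lemma perms_iff_bij_betw:
  "x \<in> perms n \<longleftrightarrow> length x = n \<and> bij_betw (nth1 x) {1..n} {1..n}"
  by (auto simp: perms_def is_perm_def distinct_iff_inj_on_nth1 set_eq_nth1_image bij_betw_def)

lemma finite_perms: "finite (perms n)"
proof (rule finite_subset)
  show "perms n \<subseteq> {xs. set xs \<subseteq> {1..n} \<and> length xs = n}"
    by (auto simp: perms_def is_perm_def)
qed (simp add: finite_lists_length_eq)

lemma perms_length: "x \<in> perms n \<Longrightarrow> length x = n"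
  by (simp add: perms_def)

lemma nth1_mem:
  assumes "x \<in> perms n" "1 \<le> i" "i \<le> n"
  shows "1 \<le> nth1 x i" "nth1 x i \<le> n"
proof -
  have "nth1 x i \<in> {1..n}"
    using assms bij_betw_apply[of "nth1 x" "{1..n}" "{1..n}" i] by (simp add: perms_iff_bij_betw)
  then show "1 \<le> nth1 x i" "nth1 x i \<le> n" by simp_all
qed

lemma nth1_eq_iff:
  assumes "x \<in> perms n" "1 \<le> i" "i \<le> n" "1 \<le> j" "j \<le> n"
  shows "nth1 x i = nth1 x j \<longleftrightarrow> i = j"
  using assms inj_on_eq_iff[of "nth1 x" "{1..n}" i j] by (simp add: perms_iff_bij_betw bij_betw_def)

lemma nth1_surj:
  assumes "x \<in> perms n" "1 \<le> a" "a \<le> n"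
  obtains i where "1 \<le> i" "i \<le> n" "nth1 x i = a"
proof -
  have "a \<in> nth1 x ` {1..n}"
    using assms by (simp add: perms_iff_bij_betw bij_betw_def)
  then show ?thesis using that by auto
qed

section \<open>Composition and inverses\<close>

lemma nth1_compose: "1 \<le> i \<Longrightarrow> i \<le> length y \<Longrightarrow> nth1 (compose x y) i = nth1 x (nth1 y i)"
  by (simp add: compose_def nth1_def)

lemma length_compose [simp]: "length (compose x y) = length y"
  by (simp add: compose_def)

lemma compose_perms:
  assumes "x \<in> perms n" "y \<in> perms n"
  shows "compose x y \<in> perms n"
proof -
  have "bij_betw (nth1 x \<circ> nth1 y) {1..n} {1..n}"
    using assms by (intro bij_betw_trans[of _ _ "{1..n}"]) (simp_all add: perms_iff_bij_betw)
  moreover have "bij_betw (nth1 x \<circ> nth1 y) {1..n} {1..n} = bij_betw (nth1 (compose x y)) {1..n} {1..n}"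
    by (rule bij_betw_cong) (use assms in \<open>simp add: nth1_compose perms_length\<close>)
  ultimately show ?thesis using assms by (simp add: perms_iff_bij_betw)
qed

lemma perm_inv_nth1:
  assumes "x \<in> perms n" "1 \<le> i" "i \<le> n"
  shows "nth1 (perm_inv x) (nth1 x i) = i"
proof -
  let ?a = "nth1 x i"
  have a: "1 \<le> ?a" "?a \<le> n" using nth1_mem assms by auto
  have "distinct x" using assms by (simp add: perms_def is_perm_def)
  have "(LEAST k. k < length x \<and> x ! k = ?a) = i - 1"
  proof (rule Least_equality)
    show "i - 1 < length x \<and> x ! (i - 1) = ?a" using assms by (auto simp: nth1_def perms_length)
    fix k assume "k < length x \<and> x ! k = ?a"
    then have "k = i - 1" using \<open>distinct x\<close> assms by (auto simp: nth1_def nth_eq_iff_index_eq perms_length)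
    then show "i - 1 \<le> k" by simp
  qed
  moreover have "nth1 (perm_inv x) a = Suc (LEAST k. k < length x \<and> x ! k = a)"
    if "1 \<le> a" "a \<le> n" for a
    using that nth_upt[of 1 "a - 1" "Suc n"] perms_length[OF assms(1)]
    by (simp add: perm_inv_def nth1_def del: upt_Suc)
  ultimately show ?thesis using assms a by simp
qed

lemma length_perm_inv [simp]: "length (perm_inv x) = length x"
  by (simp add: perm_inv_def del: upt_Suc)

lemma nth1_perm_inv:
  assumes "x \<in> perms n" "1 \<le> a" "a \<le> n"
  shows "nth1 x (nth1 (perm_inv x) a) = a"
  by (metis assms nth1_surj perm_inv_nth1)

lemma perm_inv_perms:
  assumes "x \<in> perms n"
  shows "perm_inv x \<in> perms n"
proof -
  have "bij_betw (nth1 (perm_inv x)) {1..n} {1..n}"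
  proof (rule bij_betw_byWitness[where f' = "nth1 x"])
    show "nth1 (perm_inv x) ` {1..n} \<subseteq> {1..n}"
    proof clarify
      fix a assume "a \<in> {1..n}"
      then obtain i where "1 \<le> i" "i \<le> n" "nth1 x i = a"
        using nth1_surj[OF assms, of a] by auto
      then show "nth1 (perm_inv x) a \<in> {1..n}" using perm_inv_nth1[OF assms] by auto
    qed
  qed (use assms in \<open>auto simp: nth1_perm_inv perm_inv_nth1 nth1_mem[unfolded One_nat_def]\<close>)
  then show ?thesis using assms by (simp add: perms_iff_bij_betw)
qed

text \<open>Cancellation in the symmetric group. It makes \<zeta> a function of \<open>z\<close> and
  \<open>x\<close>, so that counting all \<zeta> reduces to testing a single one.\<close>

lemma compose_perm_inv_eq_iff:
  assumes "z \<in> perms n" "\<zeta> \<in> perms n"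
  shows "compose z (perm_inv \<zeta>) = x \<longleftrightarrow> x \<in> perms n \<and> \<zeta> = compose (perm_inv x) z"
proof
  assume x: "compose z (perm_inv \<zeta>) = x"
  then have xp: "x \<in> perms n" using assms compose_perms perm_inv_perms by blast
  moreover have "\<zeta> = compose (perm_inv x) z"
  proof (rule nth1_eqI)
    fix i assume i: "1 \<le> i" "i \<le> n"
    have "nth1 x (nth1 \<zeta> i) = nth1 z i"
      using assms i x nth1_mem[OF assms(2) i] by (auto simp: nth1_compose perm_inv_nth1 perms_length)
    then show "nth1 \<zeta> i = nth1 (compose (perm_inv x) z) i"
      using perm_inv_nth1[OF xp] nth1_mem[OF assms(2) i] i assms by (metis nth1_compose perms_length)
  qed (use assms in \<open>auto simp: perms_length\<close>)
  ultimately show "x \<in> perms n \<and> \<zeta> = compose (perm_inv x) z" by simp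
next
  assume x: "x \<in> perms n \<and> \<zeta> = compose (perm_inv x) z"
  show "compose z (perm_inv \<zeta>) = x"
  proof (rule nth1_eqI)
    fix a assume a: "1 \<le> a" "a \<le> n"
    then obtain i where i: "1 \<le> i" "i \<le> n" "nth1 \<zeta> i = a" using nth1_surj assms by blast
    then have "a = nth1 (perm_inv x) (nth1 z i)" using x assms by (auto simp: nth1_compose perms_length)
    then have "nth1 x a = nth1 z i" using nth1_perm_inv x nth1_mem[OF assms(1) i(1,2)] by metis
    moreover have "nth1 (perm_inv \<zeta>) a = i" using i perm_inv_nth1 assms by blast
    ultimately show "nth1 (compose z (perm_inv \<zeta>)) a = nth1 x a"
      using a assms by (simp add: nth1_compose perms_length)
  qed (use assms x in \<open>auto simp: perms_length\<close>)
qed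

lemma nth1_compose_perm_inv:
  assumes "z \<in> perms n" "\<zeta> \<in> perms n" "1 \<le> i" "i \<le> n"
  shows "nth1 (compose z (perm_inv \<zeta>)) (nth1 \<zeta> i) = nth1 z i"
  using assms nth1_mem[OF assms(2-4)] by (auto simp: nth1_compose perm_inv_nth1 perms_length)

section \<open>Inversion sets and the weak order\<close>

lemma Inv_iff_perms:
  "x \<in> perms n \<Longrightarrow> (i, j) \<in> Inv x \<longleftrightarrow> 1 \<le> i \<and> i < j \<and> j \<le> n \<and> nth1 x j < nth1 x i"
  by (auto simp: Inv_def perms_length)

lemma finite_Inv: "finite (Inv x)"
proof (rule finite_subset)
  show "Inv x \<subseteq> {1..length x} \<times> {1..length x}" by (auto simp: Inv_def)
qed simp

text \<open>An entry equals the number of positions whose entries are at most as large, and each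
  such comparison can be read off from the inversion set. Later identities between permutations are
  checked on inversions in this way.\<close>

lemma perms_eq_of_Inv_eq:
  assumes "x \<in> perms n" "y \<in> perms n" "Inv x = Inv y"
  shows "x = y"
proof -
  have rank: "nth1 z i = card {k \<in> {1..n}. k = i \<or> k < i \<and> (k, i) \<notin> Inv z \<or> i < k \<and> (i, k) \<in> Inv z}"
    if z: "z \<in> perms n" and i: "1 \<le> i" "i \<le> n" for z i
  proof -
    have "bij_betw (nth1 z) {k \<in> {1..n}. nth1 z k \<le> nth1 z i} {1..nth1 z i}"
    proof (intro bij_betw_imageI inj_onI subset_antisym subsetI)
      fix a assume a: "a \<in> {1..nth1 z i}"
      then obtain k where "1 \<le> k" "k \<le> n" "nth1 z k = a"
        using nth1_surj[OF z, of a] nth1_mem[OF z i] by auto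
      then show "a \<in> nth1 z ` {k \<in> {1..n}. nth1 z k \<le> nth1 z i}" using a by force
    qed (use z in \<open>auto simp: nth1_eq_iff nth1_mem[unfolded One_nat_def]\<close>)
    then have "card {k \<in> {1..n}. nth1 z k \<le> nth1 z i} = nth1 z i"
      by (simp add: bij_betw_same_card)
    moreover have "{k \<in> {1..n}. nth1 z k \<le> nth1 z i} =
      {k \<in> {1..n}. k = i \<or> k < i \<and> (k, i) \<notin> Inv z \<or> i < k \<and> (i, k) \<in> Inv z}"
    proof (rule Collect_cong)
      fix k
      show "k \<in> {1..n} \<and> nth1 z k \<le> nth1 z i \<longleftrightarrow>
        k \<in> {1..n} \<and> (k = i \<or> k < i \<and> (k, i) \<notin> Inv z \<or> i < k \<and> (i, k) \<in> Inv z)"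
        using i nth1_eq_iff[OF z _ _ i, of k]
        by (cases k i rule: linorder_cases) (auto simp: Inv_iff_perms[OF z])
    qed
    ultimately show ?thesis by simp
  qed
  show ?thesis
  proof (rule nth1_eqI)
    fix i assume "1 \<le> i" "i \<le> n"
    then show "nth1 x i = nth1 y i" using rank[OF assms(1)] rank[OF assms(2)] assms(3) by simp
  qed (use assms in \<open>auto simp: perms_length\<close>)
qed

lemma weak_le_iff: "u \<in> perms n \<Longrightarrow> weak_le u v \<longleftrightarrow> v \<in> perms n \<and> Inv u \<subseteq> Inv v"
  by (auto simp: weak_le_def perms_def)

section \<open>Standardization\<close>

lemma length_st [simp]: "length (st xs) = length xs"
  by (simp add: st_def)

lemma nth1_st: "1 \<le> i \<Longrightarrow> i \<le> length xs \<Longrightarrow> nth1 (st xs) i = card {b \<in> set xs. b \<le> nth1 xs i}"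
  by (simp add: st_def nth1_def)

lemma nth1_in_set: "1 \<le> i \<Longrightarrow> i \<le> length xs \<Longrightarrow> nth1 xs i \<in> set xs"
  by (simp add: nth1_def)

lemma nth1_st_less_iff:
  assumes "1 \<le> i" "i \<le> length xs" "1 \<le> j" "j \<le> length xs"
  shows "nth1 (st xs) i < nth1 (st xs) j \<longleftrightarrow> nth1 xs i < nth1 xs j"
proof -
  have mono: "card {b \<in> set xs. b \<le> c} < card {b \<in> set xs. b \<le> d}" if "c < d" "d \<in> set xs" for c d
  proof (rule psubset_card_mono)
    have "d \<in> {b \<in> set xs. b \<le> d} - {b \<in> set xs. b \<le> c}" using that by simp
    moreover have "{b \<in> set xs. b \<le> c} \<subseteq> {b \<in> set xs. b \<le> d}" using that by auto
    ultimately show "{b \<in> set xs. b \<le> c} \<subset> {b \<in> set xs. b \<le> d}" by blast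
  qed simp
  show ?thesis
    using assms mono[of "nth1 xs i" "nth1 xs j"] mono[of "nth1 xs j" "nth1 xs i"]
      nth1_in_set[of i xs] nth1_in_set[of j xs]
    by (cases "nth1 xs i" "nth1 xs j" rule: linorder_cases) (auto simp: nth1_st)
qed

lemma Inv_st: "Inv (st xs) = Inv xs"
  by (auto simp: Inv_def nth1_st_less_iff)

lemma st_perms:
  assumes "distinct xs"
  shows "st xs \<in> perms (length xs)"
proof -
  let ?n = "length xs"
  have inj: "inj_on (nth1 (st xs)) {1..?n}"
  proof (rule inj_onI)
    fix i j assume ij: "i \<in> {1..?n}" "j \<in> {1..?n}" and eq: "nth1 (st xs) i = nth1 (st xs) j"
    then have "nth1 xs i = nth1 xs j"
      using nth1_st_less_iff[of i xs j] nth1_st_less_iff[of j xs i] by auto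
    then show "i = j" using assms ij by (auto simp: distinct_iff_inj_on_nth1 inj_on_def)
  qed
  have sub: "nth1 (st xs) ` {1..?n} \<subseteq> {1..?n}"
  proof clarify
    fix i assume i: "i \<in> {1..?n}"
    have "nth1 xs i \<in> {b \<in> set xs. b \<le> nth1 xs i}" using i nth1_in_set by auto
    then have "0 < card {b \<in> set xs. b \<le> nth1 xs i}" by (metis card_gt_0_iff empty_iff finite_set finite_Collect_conjI Collect_mem_eq)
    moreover have "card {b \<in> set xs. b \<le> nth1 xs i} \<le> card (set xs)" by (rule card_mono) auto
    ultimately show "nth1 (st xs) i \<in> {1..?n}"
      using i card_length[of xs] by (auto simp: nth1_st)
  qed
  have "bij_betw (nth1 (st xs)) {1..?n} {1..?n}"
    using inj sub by (simp add: bij_betw_def endo_inj_surj)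
  then show ?thesis by (simp add: perms_iff_bij_betw)
qed

lemma st_perm: "x \<in> perms n \<Longrightarrow> st x = x"
  by (rule perms_eq_of_Inv_eq[of _ n])
    (use st_perms[of x] in \<open>auto simp: Inv_st perms_def is_perm_def\<close>)

section \<open>Cross products, prefixes and suffixes\<close>

lemma length_cross [simp]: "length (cross a b) = length a + length b"
  by (simp add: cross_def)

lemma nth1_cross:
  assumes "1 \<le> i" "i \<le> length a + length b"
  shows "nth1 (cross a b) i =
    (if i \<le> length a then nth1 a i else length a + nth1 b (i - length a))"
proof -
  have "i - 1 < length a \<longleftrightarrow> i \<le> length a" using assms by auto
  moreover have "i - 1 - length a = i - length a - 1" by simp
  ultimately show ?thesis using assms by (auto simp: cross_def nth1_def nth_append)
qed

lemma cross_perms: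
  assumes "a \<in> perms p" "b \<in> perms q"
  shows "cross a b \<in> perms (p + q)"
proof -
  have "set (cross a b) = {1..p} \<union> (\<lambda>j. p + j) ` {1..q}"
    using assms by (auto simp: cross_def perms_def is_perm_def)
  also have "\<dots> = {1..p + q}" by (simp add: image_add_atLeastAtMost) auto
  finally have "set (cross a b) = {1..p + q}" .
  moreover have "distinct (cross a b)"
    using assms by (auto simp: cross_def perms_def is_perm_def distinct_map)
  ultimately show ?thesis using assms by (simp add: perms_def is_perm_def)
qed

text \<open>All entries of the left factor lie below all shifted entries of the right factor, so no
  inversion straddles the boundary.\<close>

lemma Inv_cross:
  assumes "a \<in> perms p" "b \<in> perms q"
  shows "(i, j) \<in> Inv (cross a b) \<longleftrightarrow> (i, j) \<in> Inv a \<or> p < i \<and> (i - p, j - p) \<in> Inv b"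
  using assms nth1_mem[OF assms(1), of i]
  by (auto simp: Inv_def nth1_cross perms_length split: if_splits)

lemma Inv_take: "(i, j) \<in> Inv (take p v) \<longleftrightarrow> j \<le> p \<and> (i, j) \<in> Inv v"
  by (auto simp: Inv_def nth1_def)

text \<open>The conjunct \<open>1 \<le> i\<close> excludes \<open>i = 0\<close>: for
  \<open>p > 0\<close> that index would stand for position \<open>p\<close> of \<open>v\<close>,
  which was dropped.\<close>

lemma Inv_drop: "(i, j) \<in> Inv (drop p v) \<longleftrightarrow> 1 \<le> i \<and> (i + p, j + p) \<in> Inv v"
  by (auto simp: Inv_def nth1_def add.commute Nat.diff_add_assoc)

section \<open>Parabolic components\<close>

lemma cross_assoc: "cross (cross a b) c = cross a (cross b c)"
  by (simp add: cross_def)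

lemma cross_Nil [simp]: "cross [] a = a" "cross a [] = a"
  by (simp_all add: cross_def)

lemma foldl_cross: "foldl cross a bs = cross a (foldl cross [] bs)"
proof (induction bs arbitrary: a)
  case (Cons b bs)
  then show ?case by (metis cross_Nil(1) cross_assoc foldl_Cons)
qed simp

text \<open>Blocks carry no index: \<open>J\<close> is a set of cuts, a cut \<open>p\<close> lying
  between positions \<open>p\<close> and \<open>p + 1\<close>. The condition is meaningful for
  \<open>i < j\<close> and vacuously true otherwise.\<close>

definition same_block :: "nat set \<Rightarrow> nat \<Rightarrow> nat \<Rightarrow> bool" where
  "same_block J i j \<longleftrightarrow> (\<forall>p\<in>J. \<not> (i \<le> p \<and> p < j))"

lemma same_block_mono: "K \<subseteq> J \<Longrightarrow> same_block J i j \<Longrightarrow> same_block K i j"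
  by (auto simp: same_block_def)

lemma same_block_empty [simp]: "same_block {} i j"
  by (simp add: same_block_def)

text \<open>Induction along the recursion of \<open>blocks\<close>: the first block is split off and
  the later cuts are shifted by \<open>p\<close>. Standardization keeps the inversions inside a
  block, and the cross product destroys those between blocks.\<close>

lemma foldl_cross_blocks:
  assumes "distinct v" "sorted_wrt (<) ps" "\<And>p. p \<in> set ps \<Longrightarrow> p < length v"
  shows "foldl cross [] (map st (blocks ps v)) \<in> perms (length v)"
    and "(i, j) \<in> Inv (foldl cross [] (map st (blocks ps v))) \<longleftrightarrow>
      (i, j) \<in> Inv v \<and> same_block (set ps) i j"
  using assms
proof (induction ps v arbitrary: i j rule: blocks.induct)
  case (1 v)
  case 1 then show ?case by (simp add: st_perms)
  case 2 then show ?case by (simp add: Inv_st)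
next
  case (2 p ps v)
  let ?qs = "map (\<lambda>q. q - p) ps"
  let ?z = "foldl cross [] (map st (blocks ?qs (drop p v)))"
  let ?a = "st (take p v)"
  \<comment> \<open>The induction hypotheses for the shifted cuts, stated under their own premises
    because each of the two conclusions below brings its own copy of them.\<close>
  have *: "?a \<in> perms p \<and> ?z \<in> perms (length v - p) \<and>
    (\<forall>i j. (i, j) \<in> Inv ?z \<longleftrightarrow> (i, j) \<in> Inv (drop p v) \<and> same_block (set ?qs) i j)"
    if "distinct v" "sorted_wrt (<) (p # ps)" "\<And>q. q \<in> set (p # ps) \<Longrightarrow> q < length v"
  proof (intro conjI allI)
    have a: "distinct (drop p v)" using that(1) by simp
    have b: "sorted_wrt (<) ?qs"
      using that(2) by (auto simp: sorted_wrt_map intro!: sorted_wrt_mono_rel[of ps "(<)"])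
    have c: "q < length (drop p v)" if "q \<in> set ?qs" for q
      using \<open>q \<in> set ?qs\<close> \<open>sorted_wrt (<) (p # ps)\<close> \<open>\<And>q. q \<in> set (p # ps) \<Longrightarrow> q < length v\<close>
      by (auto simp: diff_less_mono less_imp_le)
    show "?a \<in> perms p" using st_perms[of "take p v"] that(1) that(3)[of p] by simp
    show "?z \<in> perms (length v - p)" using 2(1)[OF a b c] by simp
    show "(i, j) \<in> Inv ?z \<longleftrightarrow> (i, j) \<in> Inv (drop p v) \<and> same_block (set ?qs) i j" for i j
      using 2(2)[OF a b c] by simp
  qed
  have eq: "foldl cross [] (map st (blocks (p # ps) v)) = cross ?a ?z"
    by (simp add: foldl_cross[of ?a])
  {
    case 1
    then show ?case using * cross_perms[of ?a p ?z "length v - p"] eq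
      by (simp add: less_imp_le)
  next
    case 2
    note z = *[OF 2]
    have gt: "p < q" if "q \<in> set ps" for q using 2(2) that by simp
    \<comment> \<open>Truncated subtraction does no harm here, as \<open>p\<close> lies strictly
      below \<open>i\<close> and below every later cut.\<close>
    have shift: "same_block (set ?qs) (i - p) (j - p) \<longleftrightarrow> same_block (set ps) i j" if "p < i"
    proof -
      have "(i - p \<le> q - p \<and> q - p < j - p) = (i \<le> q \<and> q < j)" if "q \<in> set ps" for q
        using gt[OF that] \<open>p < i\<close> by auto
      then show ?thesis unfolding same_block_def set_map ball_simps by blast
    qed
    have low: "same_block (set ps) i j" if "j \<le> p"
      using gt that by (force simp: same_block_def)
    have "(i, j) \<in> Inv (cross ?a ?z) \<longleftrightarrow> j \<le> p \<and> (i, j) \<in> Inv v \<or>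
      p < i \<and> (i - p, j - p) \<in> Inv (drop p v) \<and> same_block (set ?qs) (i - p) (j - p)"
      using z by (simp add: Inv_cross[of ?a p ?z "length v - p"] Inv_st Inv_take)
    also have "\<dots> \<longleftrightarrow> (i, j) \<in> Inv v \<and> same_block (set (p # ps)) i j"
    proof (cases "p < i")
      case True
      then have "(i - p, j - p) \<in> Inv (drop p v) \<longleftrightarrow> (i, j) \<in> Inv v"
        unfolding Inv_drop by (cases "i < j") (auto simp: Inv_def)
      moreover have "\<not> (j \<le> p \<and> (i, j) \<in> Inv v)" using True by (auto simp: Inv_def)
      ultimately show ?thesis using True shift by (auto simp: same_block_def)
    next
      case False
      then show ?thesis using low by (auto simp: same_block_def)
    qed
    finally show ?case unfolding eq .
  }
qed

text \<open>The list recursion applied to the increasing enumeration of \<open>J\<close>. Later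
  arguments reach \<open>parab\<close> almost exclusively through this description of its
  inversions.\<close>

lemma
  assumes "v \<in> perms n" "J \<subseteq> {1..<n}"
  shows parab_perms: "parab v J \<in> perms n"
    and Inv_parab: "(i, j) \<in> Inv (parab v J) \<longleftrightarrow> (i, j) \<in> Inv v \<and> same_block J i j"
proof -
  have fin: "finite J" using assms(2) finite_subset by blast
  have *: "distinct v" "sorted_wrt (<) (sorted_list_of_set J)"
    "\<And>p. p \<in> set (sorted_list_of_set J) \<Longrightarrow> p < length v"
    using assms fin by (auto simp: perms_def is_perm_def)
  show "parab v J \<in> perms n"
    using foldl_cross_blocks(1)[OF *] perms_length[OF assms(1)] by (simp add: parab_def)
  show "(i, j) \<in> Inv (parab v J) \<longleftrightarrow> (i, j) \<in> Inv v \<and> same_block J i j"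
    using foldl_cross_blocks(2)[OF *] fin by (simp add: parab_def)
qed

lemma take_drop_st_perms:
  assumes "u \<in> perms n" "p \<le> n"
  shows "st (take p u) \<in> perms p" "st (drop p u) \<in> perms (n - p)"
  using st_perms[of "take p u"] st_perms[of "drop p u"] assms
  by (auto simp: perms_def is_perm_def min_def)

text \<open>Mirrors one step of the antipode recursion: the largest cut separates a last block that
  is not cut any further. Both sides are compared by their inversions.\<close>

lemma parab_insert_max:
  assumes u: "u \<in> perms n" and p: "1 \<le> p" "p < n" and J: "J \<subseteq> {1..<p}"
  shows "parab u (insert p J) = cross (parab (st (take p u)) J) (st (drop p u))"
proof (rule perms_eq_of_Inv_eq[of _ n])
  have sub: "insert p J \<subseteq> {1..<n}" using p J by auto
  have td: "st (take p u) \<in> perms p" "st (drop p u) \<in> perms (n - p)"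
    using take_drop_st_perms[OF u] p by auto
  have pt: "parab (st (take p u)) J \<in> perms p" by (rule parab_perms[OF td(1) J])
  show "parab u (insert p J) \<in> perms n" by (rule parab_perms[OF u sub])
  show "cross (parab (st (take p u)) J) (st (drop p u)) \<in> perms n"
    using cross_perms[OF pt td(2)] p by simp
  have "(i, j) \<in> Inv (parab u (insert p J)) \<longleftrightarrow>
      (i, j) \<in> Inv (cross (parab (st (take p u)) J) (st (drop p u)))" for i j
    unfolding Inv_parab[OF u sub] Inv_cross[OF pt td(2)] Inv_parab[OF td(1) J] Inv_st Inv_take Inv_drop
  proof (cases "p < i")
    case True
    then have "1 \<le> i - p \<and> (i - p + p, j - p + p) \<in> Inv u \<longleftrightarrow> (i, j) \<in> Inv u"
      by (cases "i < j") (auto simp: Inv_def)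
    moreover have "same_block (insert p J) i j" using True J by (force simp: same_block_def)
    moreover have "\<not> (j \<le> p \<and> (i, j) \<in> Inv u)" using True by (auto simp: Inv_def)
    ultimately show "((i, j) \<in> Inv u \<and> same_block (insert p J) i j) =
      ((j \<le> p \<and> (i, j) \<in> Inv u) \<and> same_block J i j \<or> p < i \<and> 1 \<le> i - p \<and> (i - p + p, j - p + p) \<in> Inv u)"
      using True by metis
  qed (auto simp: same_block_def)
  then show "Inv (parab u (insert p J)) = Inv (cross (parab (st (take p u)) J) (st (drop p u)))"
    by auto
qed

section \<open>Descent sets and the counting of factorizations\<close>

text \<open>Inside a block every adjacent step is an ascent, and ascents chain together. This turns
  a condition on adjacent positions into one on pairs, comparable with inversions.\<close>

lemma Des_subset_iff:
  assumes "\<zeta> \<in> perms n"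
  shows "Des \<zeta> \<subseteq> J \<longleftrightarrow>
    (\<forall>i j. 1 \<le> i \<and> i < j \<and> j \<le> n \<and> same_block J i j \<longrightarrow> nth1 \<zeta> i < nth1 \<zeta> j)"
proof
  assume D: "Des \<zeta> \<subseteq> J"
  have "nth1 \<zeta> i < nth1 \<zeta> (i + Suc k)" if "1 \<le> i" "i + Suc k \<le> n" "same_block J i (i + Suc k)" for i k
    using that
  proof (induction k)
    case 0
    then have "i \<notin> Des \<zeta>" using D by (auto simp: same_block_def)
    then have "\<not> nth1 \<zeta> (i + 1) < nth1 \<zeta> i" using 0 assms by (auto simp: Des_def perms_length)
    moreover have "nth1 \<zeta> (i + 1) \<noteq> nth1 \<zeta> i" using nth1_eq_iff[OF assms] 0 by auto
    ultimately show ?case by simp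
  next
    case (Suc k)
    let ?m = "i + Suc k"
    have "?m \<notin> J" using Suc.prems(3) by (auto simp: same_block_def)
    then have "?m \<notin> Des \<zeta>" using D by blast
    then have "\<not> nth1 \<zeta> (?m + 1) < nth1 \<zeta> ?m" using Suc.prems assms by (auto simp: Des_def perms_length)
    moreover have "same_block J i ?m" unfolding same_block_def
    proof (intro ballI notI)
      fix q assume "q \<in> J" "i \<le> q \<and> q < ?m"
      then show False using Suc.prems(3) by (auto simp: same_block_def)
    qed
    then have "nth1 \<zeta> i < nth1 \<zeta> ?m" using Suc by simp
    ultimately show ?case by simp
  qed
  then show "\<forall>i j. 1 \<le> i \<and> i < j \<and> j \<le> n \<and> same_block J i j \<longrightarrow> nth1 \<zeta> i < nth1 \<zeta> j"
    by (metis less_imp_Suc_add add_Suc_right)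
next
  assume inc: "\<forall>i j. 1 \<le> i \<and> i < j \<and> j \<le> n \<and> same_block J i j \<longrightarrow> nth1 \<zeta> i < nth1 \<zeta> j"
  show "Des \<zeta> \<subseteq> J"
  proof (rule subsetI, rule ccontr)
    fix p assume p: "p \<in> Des \<zeta>" "p \<notin> J"
    then have "same_block J p (p + 1)" using le_antisym by (fastforce simp: same_block_def)
    then show False using p inc assms by (force simp: Des_def perms_length)
  qed
qed

text \<open>Says that $x^{-1} z$ increases on $J$-blocks, without requiring \<open>z\<close> and \<open>x\<close> to have
  the same length.\<close>

definition subword :: "nat set \<Rightarrow> nat list \<Rightarrow> nat list \<Rightarrow> bool" where
  "subword J z x \<longleftrightarrow> (\<forall>i j. 1 \<le> i \<and> i < j \<and> j \<le> length z \<and> same_block J i j \<longrightarrow>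
     nth1 (perm_inv x) (nth1 z i) < nth1 (perm_inv x) (nth1 z j))"

lemma Des_compose_subset_iff:
  assumes "z \<in> perms n" "x \<in> perms n"
  shows "Des (compose (perm_inv x) z) \<subseteq> J \<longleftrightarrow> subword J z x"
  using assms by (auto simp: Des_subset_iff[OF compose_perms[OF perm_inv_perms]] subword_def
      nth1_compose perms_length)

text \<open>The equation forces \<zeta> to be \<open>compose (perm_inv x) z\<close>, so the set has
  at most one element.\<close>

lemma card_factorizations:
  assumes "z \<in> perms n"
  shows "card {\<zeta> \<in> perms n. Des \<zeta> \<subseteq> J \<and> compose z (perm_inv \<zeta>) = x} =
    (if x \<in> perms n \<and> subword J z x then 1 else 0)"
proof -
  have "\<zeta> \<in> perms n \<and> Des \<zeta> \<subseteq> J \<and> compose z (perm_inv \<zeta>) = x \<longleftrightarrow>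
      x \<in> perms n \<and> subword J z x \<and> \<zeta> = compose (perm_inv x) z" for \<zeta>
  proof (cases "x \<in> perms n \<and> \<zeta> \<in> perms n")
    case True
    then show ?thesis using Des_compose_subset_iff[OF assms] compose_perm_inv_eq_iff[OF assms] by auto
  next
    case False
    then show ?thesis
      using compose_perms[OF assms perm_inv_perms] compose_perms[OF perm_inv_perms assms] by auto
  qed
  then have "{\<zeta> \<in> perms n. Des \<zeta> \<subseteq> J \<and> compose z (perm_inv \<zeta>) = x} =
    (if x \<in> perms n \<and> subword J z x then {compose (perm_inv x) z} else {})"
    by auto
  then show ?thesis by simp
qed

text \<open>The two monotonicity conditions say that \<zeta> can descend only at \<open>p\<close>,
  so this is the factorization count for the cut set \<open>{p}\<close>. The cases
  \<open>p = 0\<close> and \<open>q = 0\<close> are covered, since such a cut separates no two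
  positions.\<close>

lemma prodF_eq:
  assumes "u \<in> perms p" "v \<in> perms q"
  shows "prodF u v x = (if x \<in> perms (p + q) \<and> subword {p} (cross u v) x then 1 else 0)"
proof -
  have "{\<zeta> \<in> perms (p + q).
      (\<forall>i j. 1 \<le> i \<and> i < j \<and> j \<le> p \<longrightarrow> nth1 \<zeta> i < nth1 \<zeta> j) \<and>
      (\<forall>i j. p + 1 \<le> i \<and> i < j \<and> j \<le> p + q \<longrightarrow> nth1 \<zeta> i < nth1 \<zeta> j) \<and>
      compose (cross u v) (perm_inv \<zeta>) = x} =
    {\<zeta> \<in> perms (p + q). Des \<zeta> \<subseteq> {p} \<and> compose (cross u v) (perm_inv \<zeta>) = x}"
  proof (rule Collect_cong)
    fix \<zeta>
    have "same_block {p} i j \<longleftrightarrow> j \<le> p \<or> p + 1 \<le> i" for i j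
      by (auto simp: same_block_def)
    then have "Des \<zeta> \<subseteq> {p} \<longleftrightarrow>
      (\<forall>i j. 1 \<le> i \<and> i < j \<and> j \<le> p \<longrightarrow> nth1 \<zeta> i < nth1 \<zeta> j) \<and>
      (\<forall>i j. p + 1 \<le> i \<and> i < j \<and> j \<le> p + q \<longrightarrow> nth1 \<zeta> i < nth1 \<zeta> j)"
      if "\<zeta> \<in> perms (p + q)"
      unfolding Des_subset_iff[OF that] by (auto dest: spec2)
    then show "(\<zeta> \<in> perms (p + q) \<and>
      (\<forall>i j. 1 \<le> i \<and> i < j \<and> j \<le> p \<longrightarrow> nth1 \<zeta> i < nth1 \<zeta> j) \<and>
      (\<forall>i j. p + 1 \<le> i \<and> i < j \<and> j \<le> p + q \<longrightarrow> nth1 \<zeta> i < nth1 \<zeta> j) \<and>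
      compose (cross u v) (perm_inv \<zeta>) = x) \<longleftrightarrow>
      (\<zeta> \<in> perms (p + q) \<and> Des \<zeta> \<subseteq> {p} \<and> compose (cross u v) (perm_inv \<zeta>) = x)"
      by blast
  qed
  then show ?thesis
    using card_factorizations[OF cross_perms[OF assms], of "{p}" x] assms
    by (simp add: prodF_def perms_length)
qed

section \<open>The antipode on the fundamental basis\<close>

lemma sorted_wrt_map_nth1:
  "sorted_wrt (<) (map f c) \<longleftrightarrow>
    (\<forall>i j. 1 \<le> i \<and> i < j \<and> j \<le> length c \<longrightarrow> f (nth1 c i) < (f (nth1 c j) :: nat))"
proof
  assume s: "sorted_wrt (<) (map f c)"
  show "\<forall>i j. 1 \<le> i \<and> i < j \<and> j \<le> length c \<longrightarrow> f (nth1 c i) < f (nth1 c j)"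
  proof (intro allI impI)
    fix i j assume "1 \<le> i \<and> i < j \<and> j \<le> length c"
    then show "f (nth1 c i) < f (nth1 c j)"
      using sorted_wrt_nth_less[OF s, of "i - 1" "j - 1"] by (auto simp: nth1_def)
  qed
next
  assume s: "\<forall>i j. 1 \<le> i \<and> i < j \<and> j \<le> length c \<longrightarrow> f (nth1 c i) < f (nth1 c j)"
  show "sorted_wrt (<) (map f c)"
    unfolding sorted_wrt_iff_nth_less
  proof (intro allI impI)
    fix i j assume "i < j" "j < length (map f c)"
    then show "map f c ! i < map f c ! j"
      using s[rule_format, of "Suc i" "Suc j"] by (simp add: nth1_def)
  qed
qed

lemma subword_empty_iff: "subword {} z x \<longleftrightarrow> sorted_wrt (<) (map (nth1 (perm_inv x)) z)"
  by (simp add: subword_def sorted_wrt_map_nth1)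

lemma filter_le_perms:
  assumes "x \<in> perms n" "p \<le> n"
  shows "filter (\<lambda>a. a \<le> p) x \<in> perms p"
proof -
  let ?c = "filter (\<lambda>a. a \<le> p) x"
  have "set ?c = {1..p}" "distinct ?c" using assms by (auto simp: perms_def is_perm_def)
  moreover from this have "length ?c = p" using distinct_card[of ?c] by simp
  ultimately show ?thesis by (simp add: perms_def is_perm_def)
qed

lemma subword_filter_le:
  assumes "x \<in> perms n"
  shows "subword {} (filter (\<lambda>a. a \<le> p) x) x"
proof -
  have "sorted_wrt (<) (map (nth1 (perm_inv x)) x)"
    using perm_inv_nth1[OF assms] assms by (auto simp: sorted_wrt_map_nth1 perms_length)
  then show ?thesis
    unfolding subword_empty_iff sorted_wrt_map by (rule sorted_wrt_filter)
qed

text \<open>Both words list the letters up to \<open>p\<close> by increasing position in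
  \<open>x\<close>, and a strictly sorted list is determined by its set.\<close>

lemma subword_empty_unique:
  assumes "x \<in> perms n" "c \<in> perms p" "c' \<in> perms p" "p \<le> n" "subword {} c x" "subword {} c' x"
  shows "c = c'"
proof -
  let ?pos = "nth1 (perm_inv x)"
  have set: "set c = {1..p}" "set c' = {1..p}" using assms by (auto simp: perms_def is_perm_def)
  have "map ?pos c = map ?pos c'"
    by (rule strict_sorted_equal) (use assms set in \<open>auto simp: subword_empty_iff\<close>)
  moreover have "inj_on ?pos {1..n}"
    using perm_inv_perms[OF assms(1)] by (simp add: perms_iff_bij_betw bij_betw_def)
  then have "inj_on ?pos (set c \<union> set c')"
    by (rule inj_on_subset) (use set assms in auto)
  ultimately show ?thesis by (rule map_inj_on)
qed

text \<open>The letters up to \<open>p\<close> occur in \<open>c\<close> in the same order as in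
  \<open>x\<close>. In the induction for the antipode this transfers a condition on the restricted
  word to \<open>x\<close> itself.\<close>

lemma subword_trans_iff:
  assumes "x \<in> perms n" "c \<in> perms p" "a \<in> perms p" "subword {} c x"
  shows "subword J a c \<longleftrightarrow> subword J a x"
proof -
  let ?posx = "nth1 (perm_inv x)" and ?posc = "nth1 (perm_inv c)"
  have inc: "?posx (nth1 c k) < ?posx (nth1 c l)" if "1 \<le> k" "k < l" "l \<le> p" for k l
    using assms that by (auto simp: subword_def perms_length)
  have "?posc s < ?posc t \<longleftrightarrow> ?posx s < ?posx t" if st: "1 \<le> s" "s \<le> p" "1 \<le> t" "t \<le> p" for s t
  proof -
    obtain k l where kl: "1 \<le> k" "k \<le> p" "nth1 c k = s" "1 \<le> l" "l \<le> p" "nth1 c l = t"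
      using nth1_surj[OF assms(2)] st by metis
    then have "?posc s = k" "?posc t = l" using perm_inv_nth1[OF assms(2)] by auto
    then show ?thesis
      using kl inc[of k l] inc[of l k] by (cases k l rule: linorder_cases) auto
  qed
  then show ?thesis
    using nth1_mem[OF assms(3)] by (simp add: subword_def perms_length[OF assms(3)])
qed

text \<open>The cut \<open>p\<close> lies above all of \<open>J\<close>, so the blocks are the
  \<open>J\<close>-blocks of the first \<open>p\<close> positions and one block made of the shifted
  letters of \<open>b\<close>.\<close>

lemma subword_cross:
  assumes "a \<in> perms p" "b \<in> perms q" "J \<subseteq> {1..<p}"
  shows "subword (insert p J) (cross a b) x \<longleftrightarrow> subword J a x \<and> subword {} (map (\<lambda>j. p + j) b) x"
    (is "?L \<longleftrightarrow> ?A \<and> ?B")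
proof -
  let ?pos = "nth1 (perm_inv x)"
  have len: "length a = p" "length b = q" using assms by (auto simp: perms_length)
  have sb: "same_block (insert p J) i j \<longleftrightarrow> j \<le> p \<and> same_block J i j \<or> p < i" if "i < j" for i j
    using assms(3) that by (force simp: same_block_def)
  have B: "?B \<longleftrightarrow> (\<forall>i j. p < i \<and> i < j \<and> j \<le> p + q \<longrightarrow>
    ?pos (nth1 (cross a b) i) < ?pos (nth1 (cross a b) j))" (is "_ \<longleftrightarrow> ?B'")
  proof -
    have *: "nth1 (map (\<lambda>j. p + j) b) i = nth1 (cross a b) (i + p)" if "1 \<le> i" "i \<le> q" for i
      using that len by (simp add: nth1_cross) (simp add: nth1_def)
    show ?thesis
    proof
      assume B: ?B
      show ?B'
      proof (intro allI impI)
        fix i j assume "p < i \<and> i < j \<and> j \<le> p + q"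
        then have ij: "1 \<le> i - p" "i - p < j - p" "j - p \<le> q" "i - p \<le> q" "1 \<le> j - p" "p < i" "p < j"
          by auto
        then show "?pos (nth1 (cross a b) i) < ?pos (nth1 (cross a b) j)"
          using B[unfolded subword_def, rule_format, of "i - p" "j - p"] len
            *[OF ij(1,4)] *[OF ij(5,3)] by simp
      qed
    next
      assume B: ?B'
      show ?B unfolding subword_def
      proof (intro allI impI)
        fix i j assume "1 \<le> i \<and> i < j \<and> j \<le> length (map ((+) p) b) \<and> same_block {} i j"
        then show "?pos (nth1 (map ((+) p) b) i) < ?pos (nth1 (map ((+) p) b) j)"
          using B[rule_format, of "i + p" "j + p"] len *[of i] *[of j] by auto
      qed
    qed
  qed
  have A: "?A \<longleftrightarrow> (\<forall>i j. 1 \<le> i \<and> i < j \<and> j \<le> p \<and> same_block J i j \<longrightarrow>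
    ?pos (nth1 (cross a b) i) < ?pos (nth1 (cross a b) j))"
    using len by (auto simp: subword_def nth1_cross)
  have "?L \<longleftrightarrow> (\<forall>i j. 1 \<le> i \<and> i < j \<and> j \<le> p + q \<and> (j \<le> p \<and> same_block J i j \<or> p < i) \<longrightarrow>
    ?pos (nth1 (cross a b) i) < ?pos (nth1 (cross a b) j))"
    using len sb by (auto simp: subword_def)
  also have "\<dots> \<longleftrightarrow> ?A \<and> ?B" unfolding A B by (auto dest: spec2)
  finally show ?thesis .
qed

text \<open>The summand of Takeuchi's alternating formula for the cut set \<open>J\<close>, which
  has \<open>card J + 1\<close> blocks. The indicator is the coefficient of \<open>F x\<close> in
  the product of the basis elements of the standardized blocks.\<close>

definition takeuchi_term :: "nat \<Rightarrow> nat list \<Rightarrow> nat list \<Rightarrow> nat set \<Rightarrow> rat" where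
  "takeuchi_term n u x J =
    (-1) ^ (card J + 1) * (if x \<in> perms n \<and> subword J (parab u J) x then 1 else 0)"

text \<open>Nonempty subsets are grouped by their largest element \<open>p\<close>; removing it
  leaves an arbitrary set of smaller positive numbers.\<close>

lemma sum_Pow_by_Max:
  fixes n :: nat
  assumes "1 \<le> n"
  shows "(\<Sum>J\<in>Pow {1..<n}. f J) = f {} + (\<Sum>p=1..<n. \<Sum>J\<in>Pow {1..<p}. f (insert p J) :: rat)"
  using assms
proof (induction n rule: nat_induct_at_least)
  case (Suc n)
  have eq: "{1..<Suc n} = insert n {1..<n}" using Suc by auto
  have "(\<Sum>J\<in>Pow {1..<Suc n}. f J) = (\<Sum>J\<in>Pow {1..<n}. f J) + (\<Sum>J\<in>insert n ` Pow {1..<n}. f J)"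
    unfolding eq Pow_insert by (rule sum.union_disjoint) auto
  also have "(\<Sum>J\<in>insert n ` Pow {1..<n}. f J) = (\<Sum>J\<in>Pow {1..<n}. f (insert n J))"
  proof (subst sum.reindex)
    show "inj_on (insert n) (Pow {1..<n})"
    proof (rule inj_onI)
      fix K L assume "K \<in> Pow {1..<n}" "L \<in> Pow {1..<n}" and e: "insert n K = insert n L"
      then have "n \<notin> K" "n \<notin> L" by auto
      then show "K = L" using e insert_ident by metis
    qed
  qed simp
  finally show ?case using Suc by simp
qed simp

lemma supp_F [simp]: "supp (F b) = {b}"
  by (auto simp: supp_def F_def)

text \<open>For given \<open>x\<close> only one left factor can produce \<open>F x\<close>, namely
  the restriction of \<open>x\<close> to the letters up to \<open>p\<close>. So each coefficient of
  the product is zero or one coefficient of \<open>g\<close>.\<close>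

lemma mult_F_right:
  assumes "supp g \<subseteq> perms p" "b \<in> perms q"
  shows "mult g (F b) x = (if x \<in> perms (p + q) \<and> subword {} (map (\<lambda>j. p + j) b) x
    then g (filter (\<lambda>a. a \<le> p) x) else 0)"
proof -
  let ?c = "filter (\<lambda>a. a \<le> p) x"
  let ?R = "subword {} (map (\<lambda>j. p + j) b) x"
  have "mult g (F b) x = (\<Sum>a\<in>supp g. g a * prodF a b x)"
    unfolding mult_def by (simp only: supp_F) (simp add: F_def)
  also have "\<dots> = (\<Sum>a\<in>perms p. g a * prodF a b x)"
    by (rule sum.mono_neutral_left) (use assms finite_perms in \<open>auto simp: supp_def\<close>)
  also have "\<dots> = (\<Sum>a\<in>perms p. if a = ?c then (if x \<in> perms (p + q) \<and> ?R then g ?c else 0) else 0)"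
  proof (rule sum.cong[OF refl])
    fix a assume a: "a \<in> perms p"
    have "subword {} a x \<longleftrightarrow> a = ?c" if x: "x \<in> perms (p + q)"
      using subword_filter_le[OF x, of p] filter_le_perms[OF x, of p]
        subword_empty_unique[OF x a, of ?c] by auto
    then show "g a * prodF a b x =
      (if a = ?c then (if x \<in> perms (p + q) \<and> ?R then g ?c else 0) else 0)"
      unfolding prodF_eq[OF a assms(2)] subword_cross[OF a assms(2) empty_subsetI] by auto
  qed
  also have "\<dots> = (if x \<in> perms (p + q) \<and> ?R then g ?c else 0)"
    using filter_le_perms[of x "p + q" p] finite_perms[of p] by (simp add: sum.delta)
  finally show ?thesis .
qed

declare antiF.simps [simp del]

lemma antiF_Nil: "antiF [] = F []"
  by (simp add: antiF.simps)

text \<open>Strong induction on the degree. The recursion splits off the last block at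
  \<open>p\<close>, so its summand for \<open>p\<close> collects the cut sets with maximum
  \<open>p\<close>, and \<open>p = 0\<close> yields the empty cut set.\<close>

lemma antiF_eq_sum:
  assumes "u \<in> perms n" "1 \<le> n"
  shows "antiF u x = (\<Sum>J\<in>Pow {1..<n}. takeuchi_term n u x J)"
  using assms
proof (induction n arbitrary: u x rule: less_induct)
  case (less n)
  note u = less.prems(1)
  let ?R = "\<lambda>p. subword {} (map (\<lambda>j. p + j) (st (drop p u))) x"
  let ?c = "\<lambda>p. filter (\<lambda>a. a \<le> p) x"
  have len: "length u = n" using u by (rule perms_length)
  \<comment> \<open>The case \<open>p = 0\<close> is separate because the induction hypothesis
    starts in degree 1.\<close>
  have supp: "supp (antiF (st (take p u))) \<subseteq> perms p" if "p < n" for p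
  proof (cases "p = 0")
    case True
    then show ?thesis by (auto simp: antiF_Nil supp_def st_def F_def perms_def is_perm_def split: if_splits)
  next
    case False
    then have "antiF (st (take p u)) y = (\<Sum>J\<in>Pow {1..<p}. takeuchi_term p (st (take p u)) y J)" for y
      using less.IH[OF that] take_drop_st_perms(1)[OF u] that by simp
    then have "antiF (st (take p u)) y = 0" if "y \<notin> perms p" for y
      using that by (simp add: takeuchi_term_def)
    then show ?thesis unfolding supp_def by blast
  qed
  have m: "mult (antiF (st (take p u))) (F (st (drop p u))) x =
     (if x \<in> perms n \<and> ?R p then antiF (st (take p u)) (?c p) else 0)" if "p < n" for p
    using mult_F_right[OF supp[OF that] take_drop_st_perms(2)[OF u]] that by simp
  \<comment> \<open>Here the whole word is one block.\<close>
  have zero: "(if x \<in> perms n \<and> ?R 0 then antiF (st (take 0 u)) (?c 0) else 0) = - takeuchi_term n u x {}"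
  proof -
    have "x \<in> perms n \<Longrightarrow> ?c 0 = []" by (auto simp: perms_def is_perm_def filter_empty_conv)
    moreover have "parab u {} = u" by (simp add: parab_def st_perm[OF u])
    ultimately show ?thesis
      using st_perm[OF u] by (auto simp: takeuchi_term_def F_def antiF_Nil st_def[of "[]"])
  qed
  \<comment> \<open>Appending the last block turns a cut set \<open>J\<close> of the prefix into
    \<open>insert p J\<close>; the additional block accounts for the minus sign.\<close>
  have pos: "(if x \<in> perms n \<and> ?R p then antiF (st (take p u)) (?c p) else 0) =
    - (\<Sum>J\<in>Pow {1..<p}. takeuchi_term n u x (insert p J))" if p: "1 \<le> p" "p < n" for p
  proof (cases "x \<in> perms n")
    case True
    have td: "st (take p u) \<in> perms p" "st (drop p u) \<in> perms (n - p)"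
      using take_drop_st_perms[OF u] p by auto
    have c: "?c p \<in> perms p" using filter_le_perms[OF True] p by simp
    have "(if ?R p then 1 else 0) * takeuchi_term p (st (take p u)) (?c p) J =
        - takeuchi_term n u x (insert p J)" if J: "J \<in> Pow {1..<p}" for J
    proof -
      have J: "J \<subseteq> {1..<p}" using that by simp
      have fin: "finite J" using J finite_subset by blast
      have "p \<notin> J" using J by auto
      then have card: "card (insert p J) = Suc (card J)" using fin by simp
      have pj: "parab (st (take p u)) J \<in> perms p" by (rule parab_perms[OF td(1) J])
      have "subword (insert p J) (parab u (insert p J)) x \<longleftrightarrow> subword J (parab (st (take p u)) J) (?c p) \<and> ?R p"
        unfolding parab_insert_max[OF u p J] subword_cross[OF pj td(2) J]
          subword_trans_iff[OF True c pj subword_filter_le[OF True]] ..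
      then show ?thesis using True c by (simp add: takeuchi_term_def card)
    qed
    then have "(\<Sum>J\<in>Pow {1..<p}. (if ?R p then 1 else 0) * takeuchi_term p (st (take p u)) (?c p) J) =
      - (\<Sum>J\<in>Pow {1..<p}. takeuchi_term n u x (insert p J))"
      by (simp add: sum_negf[symmetric])
    moreover have "antiF (st (take p u)) (?c p) = (\<Sum>J\<in>Pow {1..<p}. takeuchi_term p (st (take p u)) (?c p) J)"
      using less.IH[OF p(2) td(1) p(1)] .
    ultimately show ?thesis using True by (simp add: sum_distrib_left[symmetric] split: if_splits)
  next
    case False
    then show ?thesis by (simp add: takeuchi_term_def)
  qed
  have "antiF u x = - (\<Sum>p<n. mult (antiF (st (take p u))) (F (st (drop p u))) x)"
    using len less.prems(2) by (subst antiF.simps) auto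
  also have "(\<Sum>p<n. mult (antiF (st (take p u))) (F (st (drop p u))) x) =
    (\<Sum>p<n. if x \<in> perms n \<and> ?R p then antiF (st (take p u)) (?c p) else 0)"
    by (rule sum.cong) (simp_all add: m)
  also have "{..<n} = insert 0 {1..<n}" using less.prems(2) by auto
  also have "(\<Sum>p\<in>insert 0 {1..<n}. if x \<in> perms n \<and> ?R p then antiF (st (take p u)) (?c p) else 0) =
     - takeuchi_term n u x {} + (\<Sum>p=1..<n. - (\<Sum>J\<in>Pow {1..<p}. takeuchi_term n u x (insert p J)))"
    by (subst sum.insert) (auto simp only: zero intro!: arg_cong2[where f = "(+)"] sum.cong pos, auto)
  also have "- \<dots> = (\<Sum>J\<in>Pow {1..<n}. takeuchi_term n u x J)"
    unfolding sum_Pow_by_Max[OF less.prems(2)] by (simp add: sum_negf)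
  finally show ?case .
qed

section \<open>Moebius inversion\<close>

lemma weak_le_perms: "weak_le u v \<Longrightarrow> u \<in> perms n \<longleftrightarrow> v \<in> perms n"
  by (auto simp: weak_le_def perms_def)

lemma weak_le_refl: "u \<in> perms n \<Longrightarrow> weak_le u u"
  by (simp add: weak_le_iff)

lemma weak_le_trans: "weak_le u v \<Longrightarrow> weak_le v w \<Longrightarrow> weak_le u w"
  by (auto simp: weak_le_def)

lemma weak_le_antisym: "weak_le u v \<Longrightarrow> weak_le v u \<Longrightarrow> u = v"
  using perms_eq_of_Inv_eq[of u "length u" v] by (auto simp: weak_le_def perms_def)

lemma card_Inv_less:
  assumes "weak_le u v" "u \<noteq> v"
  shows "card (Inv u) < card (Inv v)"
proof (rule psubset_card_mono[OF finite_Inv])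
  have "Inv u \<noteq> Inv v" using assms perms_eq_of_Inv_eq[of u "length u" v] by (auto simp: weak_le_def perms_def)
  then show "Inv u \<subset> Inv v" using assms by (auto simp: weak_le_def)
qed

text \<open>A solution of the recursion behind \<open>mu\<close>, by recursion on the number of
  inversions of the upper end. It serves as the witness that the definite description denotes
  something.\<close>

function moebius :: "nat list \<Rightarrow> nat list \<Rightarrow> rat" where
  "moebius u v = (if weak_le u v then
      (if u = v then 1 else - (\<Sum>z\<in>{z. weak_le u z \<and> weak_le z v \<and> z \<noteq> v}. moebius u z))
    else 0)"
  by auto
termination
  by (relation "measure (\<lambda>(u, v). card (Inv v))") (auto simp: card_Inv_less)

declare moebius.simps [simp del]

text \<open>Existence is witnessed by \<open>moebius\<close>; uniqueness follows by induction on the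
  number of inversions of \<open>v\<close>.\<close>

lemma mu_rec: "mu u v = (if weak_le u v then
    (if u = v then 1 else - (\<Sum>z\<in>{z. weak_le u z \<and> weak_le z v \<and> z \<noteq> v}. mu u z))
  else 0)"
proof -
  let ?P = "\<lambda>f :: nat list \<Rightarrow> nat list \<Rightarrow> rat. \<forall>u v. f u v = (if weak_le u v then
    (if u = v then 1 else - (\<Sum>z\<in>{z. weak_le u z \<and> weak_le z v \<and> z \<noteq> v}. f u z)) else 0)"
  have "\<exists>!f. ?P f"
  proof (rule ex1I)
    show "?P moebius" by (intro allI) (rule moebius.simps)
    fix f assume f: "?P f"
    have "f u v = moebius u v" for u v
    proof (induction v rule: measure_induct_rule[of "\<lambda>v. card (Inv v)"])
      case (less v)
      have "(\<Sum>z\<in>{z. weak_le u z \<and> weak_le z v \<and> z \<noteq> v}. f u z) =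
        (\<Sum>z\<in>{z. weak_le u z \<and> weak_le z v \<and> z \<noteq> v}. moebius u z)"
        by (rule sum.cong) (auto intro: less card_Inv_less)
      then show ?case by (subst f[rule_format]) (simp add: moebius.simps[of u v])
    qed
    then show "f = moebius" by blast
  qed
  from theI'[OF this] show ?thesis unfolding mu_def by blast
qed

lemma mu_eq_0: "\<not> weak_le u v \<Longrightarrow> mu u v = 0"
  by (simp add: mu_rec)

lemma M_eq_mu: "M u x = mu u x"
  by (simp add: M_def mu_eq_0)

text \<open>The recursion for \<open>mu u v\<close> moved to one side: in the incidence algebra,
  \<open>mu\<close> times the zeta function is the identity.\<close>

lemma sum_mu_weak_le:
  assumes "u \<in> perms n" "v \<in> perms n"
  shows "(\<Sum>z\<in>perms n. mu u z * of_bool (weak_le z v)) = of_bool (u = v)"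
proof -
  let ?I = "{z. weak_le u z \<and> weak_le z v}"
  have I: "?I \<subseteq> perms n" using assms weak_le_perms by blast
  then have fin: "finite ?I" using finite_perms finite_subset by blast
  have "(\<Sum>z\<in>perms n. mu u z * of_bool (weak_le z v)) = (\<Sum>z\<in>?I. mu u z)"
    by (rule sum.mono_neutral_cong_right) (use I finite_perms mu_eq_0 in auto)
  also have "\<dots> = of_bool (u = v)"
  proof (cases "weak_le u v")
    case True
    show ?thesis
    proof (cases "u = v")
      case True
      then have "?I = {u}" using weak_le_antisym weak_le_refl[OF assms(1)] by blast
      then show ?thesis using True \<open>weak_le u v\<close> by (simp add: mu_rec)
    next
      case False
      have eq: "?I = insert v {z. weak_le u z \<and> weak_le z v \<and> z \<noteq> v}"
        using True weak_le_refl[OF assms(2)] by blast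
      have "finite {z. weak_le u z \<and> weak_le z v \<and> z \<noteq> v}" using fin eq by simp
      then show ?thesis using False True unfolding eq by (simp add: mu_rec[of u v])
    qed
  next
    case False
    then have "?I = {}" using weak_le_trans by blast
    moreover have "u \<noteq> v" using False weak_le_refl[OF assms(1)] by blast
    ultimately show ?thesis by (simp only: sum.empty) simp
  qed
  finally show ?thesis .
qed

text \<open>In the incidence algebra, $\mu * (\zeta * \mu) = \mu$ forces $\zeta * \mu = 1$ by induction
  along the interval, because $\mu(u,u) = 1$.\<close>

lemma sum_weak_le_mu:
  assumes "u \<in> perms n" "v \<in> perms n"
  shows "(\<Sum>z\<in>perms n. of_bool (weak_le u z) * mu z v) = of_bool (u = v)"
proof -
  define h where "h u = (\<Sum>z\<in>perms n. of_bool (weak_le u z) * mu z v)" for u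
  have h0: "h z = 0" if "\<not> weak_le z v" for z
    unfolding h_def using that weak_le_trans mu_eq_0 by (intro sum.neutral) fastforce
  have conv: "(\<Sum>z\<in>perms n. mu u z * h z) = mu u v" if u: "u \<in> perms n" for u
  proof -
    have "(\<Sum>z\<in>perms n. mu u z * h z) =
      (\<Sum>z\<in>perms n. \<Sum>t\<in>perms n. mu u z * of_bool (weak_le z t) * mu t v)"
      by (simp add: h_def sum_distrib_left mult.assoc)
    also have "\<dots> = (\<Sum>t\<in>perms n. (\<Sum>z\<in>perms n. mu u z * of_bool (weak_le z t)) * mu t v)"
      by (subst sum.swap) (simp add: sum_distrib_right)
    also have "\<dots> = (\<Sum>t\<in>perms n. if t = u then mu u v else 0)"
      by (rule sum.cong) (auto simp: sum_mu_weak_le[OF u])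
    also have "\<dots> = mu u v" using u finite_perms[of n] by simp
    finally show ?thesis .
  qed
  have "h u = of_bool (u = v)" if "u \<in> perms n" for u
    using that
  proof (induction u rule: measure_induct_rule[of "\<lambda>u. card (Inv v) - card (Inv u)"])
    case (less u)
    have muu: "mu u u = 1" using weak_le_refl[OF less.prems] by (simp add: mu_rec)
    \<comment> \<open>Away from \<open>u\<close> at most one term survives, at \<open>z = v\<close>,
      where \<open>h\<close> is 1; it occurs only when \<open>v\<close> differs from
      \<open>u\<close>.\<close>
    have IH: "mu u z * h z = (if z = v then mu u v * of_bool (u \<noteq> v) else 0)"
      if z: "z \<in> perms n" "z \<noteq> u" for z
    proof (cases "weak_le u z \<and> weak_le z v")
      case True
      then have "card (Inv u) < card (Inv z)" using card_Inv_less z by metis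
      moreover have "card (Inv z) \<le> card (Inv v)"
        using True by (auto simp: weak_le_def intro: card_mono finite_Inv)
      ultimately have "h z = of_bool (z = v)" using less.IH[of z] z by simp
      then show ?thesis using z by auto
    next
      case False
      then show ?thesis using mu_eq_0 h0 weak_le_refl[OF z(1)] by auto
    qed
    have "mu u v = (\<Sum>z\<in>perms n. mu u z * h z)" using conv[OF less.prems] ..
    also have "\<dots> = mu u u * h u + (\<Sum>z\<in>perms n - {u}. mu u z * h z)"
      by (rule sum.remove[OF finite_perms less.prems])
    also have "(\<Sum>z\<in>perms n - {u}. mu u z * h z) =
      (\<Sum>z\<in>perms n - {u}. if z = v then mu u v * of_bool (u \<noteq> v) else 0)"
      by (rule sum.cong) (use IH in auto)
    also have "\<dots> = mu u v * of_bool (u \<noteq> v)"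
      using assms(2) finite_perms[of n] by (simp add: sum.delta)
    finally have "mu u v = h u + mu u v * of_bool (u \<noteq> v)" using muu by simp
    then show ?case using muu by (cases "u = v") auto
  qed
  then show ?thesis using assms unfolding h_def by blast
qed

section \<open>Relative order on blocks\<close>

text \<open>For permutations of [n] and cuts in [n-1] this says that \<open>parab v J\<close> lies
  below \<open>parab y J\<close> in the weak order.\<close>

definition le_on_blocks :: "nat set \<Rightarrow> nat list \<Rightarrow> nat list \<Rightarrow> bool" where
  "le_on_blocks J v y \<longleftrightarrow> (\<forall>i j. same_block J i j \<and> (i, j) \<in> Inv v \<longrightarrow> (i, j) \<in> Inv y)"

text \<open>Likewise, this is the equality of \<open>parab v J\<close> and
  \<open>parab y J\<close>.\<close>

definition agree_on_blocks :: "nat set \<Rightarrow> nat list \<Rightarrow> nat list \<Rightarrow> bool" where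
  "agree_on_blocks J v y \<longleftrightarrow> (\<forall>i j. same_block J i j \<longrightarrow> ((i, j) \<in> Inv v \<longleftrightarrow> (i, j) \<in> Inv y))"

lemma agree_on_blocks_mono: "K \<subseteq> J \<Longrightarrow> agree_on_blocks K v y \<Longrightarrow> agree_on_blocks J v y"
  using same_block_mono by (auto simp: agree_on_blocks_def)

text \<open>Inversions of the composite, written as \<open>(nth1 \<zeta> i, nth1 \<zeta> j)\<close>,
  are of two kinds. Those with \<open>j < i\<close> are exactly the inversions of
  \<open>perm_inv \<zeta>\<close>: since \<zeta> increases on blocks, \<open>j\<close> and
  \<open>i\<close> lie in different blocks, and \<open>parab v J\<close> has no inversion there.
  Those with \<open>i < j\<close> come from inversions of \<open>parab v J\<close>, and bounding
  them by \<open>w\<close> is a condition on \<open>compose w \<zeta>\<close>.\<close>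

lemma weak_le_parab_iff:
  assumes v: "v \<in> perms n" and w: "w \<in> perms n" and \<zeta>: "\<zeta> \<in> perms n"
    and J: "J \<subseteq> {1..<n}" "Des \<zeta> \<subseteq> J"
  shows "weak_le (compose (parab v J) (perm_inv \<zeta>)) w \<longleftrightarrow>
    weak_le (perm_inv \<zeta>) w \<and> le_on_blocks J v (compose w \<zeta>)"
proof -
  let ?z = "parab v J"
  let ?s = "compose ?z (perm_inv \<zeta>)" and ?y = "compose w \<zeta>"
  have z: "?z \<in> perms n" by (rule parab_perms[OF v J(1)])
  have \<zeta>': "perm_inv \<zeta> \<in> perms n" by (rule perm_inv_perms[OF \<zeta>])
  have s: "?s \<in> perms n" by (rule compose_perms[OF z \<zeta>'])
  have y: "?y \<in> perms n" by (rule compose_perms[OF w \<zeta>])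
  have inc: "nth1 \<zeta> i < nth1 \<zeta> j" if "1 \<le> i" "i < j" "j \<le> n" "same_block J i j" for i j
    using J(2) that unfolding Des_subset_iff[OF \<zeta>] by blast
  have Inv_s: "(nth1 \<zeta> i, nth1 \<zeta> j) \<in> Inv ?s \<longleftrightarrow> nth1 \<zeta> i < nth1 \<zeta> j \<and> nth1 ?z j < nth1 ?z i"
    if "1 \<le> i" "i \<le> n" "1 \<le> j" "j \<le> n" for i j
    using that nth1_mem[OF \<zeta>] by (simp add: Inv_iff_perms[OF s] nth1_compose_perm_inv[OF z \<zeta>])
  have Inv_\<zeta>': "(nth1 \<zeta> i, nth1 \<zeta> j) \<in> Inv (perm_inv \<zeta>) \<longleftrightarrow> nth1 \<zeta> i < nth1 \<zeta> j \<and> j < i"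
    if "1 \<le> i" "i \<le> n" "1 \<le> j" "j \<le> n" for i j
    using that nth1_mem[OF \<zeta>] by (simp add: Inv_iff_perms[OF \<zeta>'] perm_inv_nth1[OF \<zeta>])
  have Inv_y: "(i, j) \<in> Inv ?y \<longleftrightarrow> 1 \<le> i \<and> i < j \<and> j \<le> n \<and> nth1 w (nth1 \<zeta> j) < nth1 w (nth1 \<zeta> i)" for i j
    using perms_length[OF \<zeta>] by (auto simp: Inv_iff_perms[OF y] nth1_compose)
  \<comment> \<open>As \<zeta> is onto, its values cover all positions. The indices \<open>i\<close>
    and \<open>j\<close> stay unordered, because an inversion of \<open>x\<close> fixes only the
    order of their images.\<close>
  have subset_w: "Inv x \<subseteq> Inv w \<longleftrightarrow> (\<forall>i j. 1 \<le> i \<and> i \<le> n \<and> 1 \<le> j \<and> j \<le> n \<longrightarrow>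
      (nth1 \<zeta> i, nth1 \<zeta> j) \<in> Inv x \<longrightarrow> nth1 w (nth1 \<zeta> j) < nth1 w (nth1 \<zeta> i))" (is "_ \<longleftrightarrow> ?R")
    if x: "x \<in> perms n" for x
  proof
    assume "Inv x \<subseteq> Inv w"
    then show ?R by (auto simp: Inv_iff_perms[OF w] dest: subsetD)
  next
    assume R: ?R
    show "Inv x \<subseteq> Inv w"
    proof clarify
      fix a b assume ab: "(a, b) \<in> Inv x"
      then have ab': "1 \<le> a" "a < b" "b \<le> n" by (auto simp: Inv_iff_perms[OF x])
      obtain i where i: "1 \<le> i" "i \<le> n" "nth1 \<zeta> i = a" using nth1_surj[OF \<zeta>, of a] ab' by auto
      obtain j where j: "1 \<le> j" "j \<le> n" "nth1 \<zeta> j = b" using nth1_surj[OF \<zeta>, of b] ab' by auto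
      show "(a, b) \<in> Inv w" using R i j ab ab' by (auto simp: Inv_iff_perms[OF w])
    qed
  qed
  have Inv_z: "(i, j) \<in> Inv v \<and> same_block J i j \<longleftrightarrow> 1 \<le> i \<and> i < j \<and> j \<le> n \<and> nth1 ?z j < nth1 ?z i" for i j
    using Inv_parab[OF v J(1), of i j] by (simp add: Inv_iff_perms[OF z])
  show ?thesis
  proof
    assume "weak_le ?s w"
    then have "Inv ?s \<subseteq> Inv w" by (simp add: weak_le_iff[OF s])
    then have sw: "nth1 w (nth1 \<zeta> j) < nth1 w (nth1 \<zeta> i)"
      if "1 \<le> i" "i \<le> n" "1 \<le> j" "j \<le> n" "nth1 \<zeta> i < nth1 \<zeta> j" "nth1 ?z j < nth1 ?z i" for i j
      using that Inv_s unfolding subset_w[OF s] by blast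
    have "Inv (perm_inv \<zeta>) \<subseteq> Inv w"
      unfolding subset_w[OF \<zeta>']
    proof (intro allI impI)
      fix i j assume ij: "1 \<le> i \<and> i \<le> n \<and> 1 \<le> j \<and> j \<le> n" "(nth1 \<zeta> i, nth1 \<zeta> j) \<in> Inv (perm_inv \<zeta>)"
      then have *: "nth1 \<zeta> i < nth1 \<zeta> j" "j < i" using Inv_\<zeta>' by auto
      \<comment> \<open>An inversion of \<open>perm_inv \<zeta>\<close> joins different blocks, so
        \<open>parab v J\<close> increases from \<open>j\<close> to \<open>i\<close> and the pair is
        also an inversion of the composite.\<close>
      then have "\<not> same_block J j i" using inc[of j i] ij by auto
      then have "\<not> nth1 ?z i < nth1 ?z j" using Inv_z[of j i] ij * by auto
      moreover have "nth1 ?z i \<noteq> nth1 ?z j" using nth1_eq_iff[OF z] ij * by auto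
      ultimately show "nth1 w (nth1 \<zeta> j) < nth1 w (nth1 \<zeta> i)" using sw ij * by auto
    qed
    moreover have "le_on_blocks J v ?y"
      unfolding le_on_blocks_def
    proof (intro allI impI)
      fix i j assume ij: "same_block J i j \<and> (i, j) \<in> Inv v"
      then have *: "1 \<le> i" "i < j" "j \<le> n" "nth1 ?z j < nth1 ?z i" using Inv_z by blast+
      then show "(i, j) \<in> Inv ?y" using inc[of i j] sw[of i j] ij by (auto simp: Inv_y)
    qed
    ultimately show "weak_le (perm_inv \<zeta>) w \<and> le_on_blocks J v ?y"
      using w by (simp add: weak_le_iff[OF \<zeta>'])
  next
    assume A: "weak_le (perm_inv \<zeta>) w \<and> le_on_blocks J v ?y"
    then have sub: "Inv (perm_inv \<zeta>) \<subseteq> Inv w" by (simp add: weak_le_iff[OF \<zeta>'])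
    have "Inv ?s \<subseteq> Inv w"
      unfolding subset_w[OF s]
    proof (intro allI impI)
      fix i j assume ij: "1 \<le> i \<and> i \<le> n \<and> 1 \<le> j \<and> j \<le> n" "(nth1 \<zeta> i, nth1 \<zeta> j) \<in> Inv ?s"
      then have *: "nth1 \<zeta> i < nth1 \<zeta> j" "nth1 ?z j < nth1 ?z i" using Inv_s by auto
      then have "i \<noteq> j" by auto
      then consider "j < i" | "i < j" by linarith
      then show "nth1 w (nth1 \<zeta> j) < nth1 w (nth1 \<zeta> i)"
      proof cases
        case 1
        then have "(nth1 \<zeta> i, nth1 \<zeta> j) \<in> Inv (perm_inv \<zeta>)" using Inv_\<zeta>' ij * by blast
        then show ?thesis using sub by (auto simp: Inv_iff_perms[OF w] dest: subsetD)
      next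
        case 2
        then have "(i, j) \<in> Inv v \<and> same_block J i j" using Inv_z ij * by blast
        then have "(i, j) \<in> Inv ?y" using A unfolding le_on_blocks_def by blast
        then show ?thesis by (simp add: Inv_y)
      qed
    qed
    then show "weak_le ?s w" using w by (simp add: weak_le_iff[OF s])
  qed
qed

section \<open>Permutations with prescribed global descents\<close>

text \<open>Positions are ranked first by block, earlier blocks receiving larger values, and then by
  \<open>y\<close>; standardizing these keys gives the permutation.\<close>

lemma ex_perm_with_global_descents:
  assumes y: "y \<in> perms n" and J: "finite J"
  obtains v where "v \<in> perms n"
    "\<And>i j. (i, j) \<in> Inv v \<longleftrightarrow> 1 \<le> i \<and> i < j \<and> j \<le> n \<and> (same_block J i j \<longrightarrow> (i, j) \<in> Inv y)"
proof
  \<comment> \<open>The weight \<open>Suc n\<close> exceeds every entry of \<open>y\<close>, so the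
    number of cuts from \<open>i\<close> onwards decides first. Earlier blocks have more such
    cuts.\<close>
  define f where "f i = card {p \<in> J. i \<le> p} * Suc n + nth1 y i" for i
  define xs where "xs = map f [1..<Suc n]"
  have len: "length xs = n" by (simp add: xs_def)
  have nth: "nth1 xs i = f i" if "1 \<le> i" "i \<le> n" for i
    using that nth_upt[of 1 "i - 1" "Suc n"] by (simp add: xs_def nth1_def del: upt_Suc)
  have same: "f i = card {p \<in> J. j \<le> p} * Suc n + nth1 y i" if "same_block J i j" "i < j" for i j
  proof -
    have "{p \<in> J. i \<le> p} = {p \<in> J. j \<le> p}" using that by (force simp: same_block_def)
    then show ?thesis by (simp add: f_def)
  qed
  have diff: "f j < f i" if ij: "\<not> same_block J i j" "1 \<le> i" "i < j" "j \<le> n" for i j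
  proof -
    obtain q where q: "q \<in> J" "i \<le> q" "q < j" using ij by (auto simp: same_block_def)
    have "{p \<in> J. j \<le> p} \<subset> {p \<in> J. i \<le> p}"
    proof
      show "{p \<in> J. j \<le> p} \<subseteq> {p \<in> J. i \<le> p}" using ij by auto
      have "q \<in> {p \<in> J. i \<le> p}" "q \<notin> {p \<in> J. j \<le> p}" using q by auto
      then show "{p \<in> J. j \<le> p} \<noteq> {p \<in> J. i \<le> p}" by blast
    qed
    then have "card {p \<in> J. j \<le> p} < card {p \<in> J. i \<le> p}" using J by (intro psubset_card_mono) auto
    then have "Suc (card {p \<in> J. j \<le> p}) * Suc n \<le> card {p \<in> J. i \<le> p} * Suc n"
      by (intro mult_le_mono1) simp
    moreover have "nth1 y j \<le> n" using nth1_mem[OF y, of j] ij by simp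
    ultimately show ?thesis by (simp add: f_def)
  qed
  have neq: "f i \<noteq> f j" if "1 \<le> i" "i < j" "j \<le> n" for i j
  proof (cases "same_block J i j")
    case True
    then show ?thesis using same[OF True] that nth1_eq_iff[OF y, of i j] by (auto simp: f_def[of j])
  next
    case False
    then show ?thesis using diff[OF False] that by simp
  qed
  have "distinct xs"
    unfolding distinct_iff_inj_on_nth1 len
    by (rule linorder_inj_onI) (use neq in \<open>auto simp: nth\<close>)
  then show "st xs \<in> perms n" using st_perms[of xs] len by simp
  show "(i, j) \<in> Inv (st xs) \<longleftrightarrow> 1 \<le> i \<and> i < j \<and> j \<le> n \<and> (same_block J i j \<longrightarrow> (i, j) \<in> Inv y)" for i j
  proof -
    have "(i, j) \<in> Inv (st xs) \<longleftrightarrow> 1 \<le> i \<and> i < j \<and> j \<le> n \<and> f j < f i"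
      unfolding Inv_st using nth[of i] nth[of j] by (auto simp: Inv_def len)
    moreover have "f j < f i \<longleftrightarrow> nth1 y j < nth1 y i" if "same_block J i j" "i < j"
      using same[OF that] by (simp add: f_def[of j])
    moreover have "f j < f i" if "\<not> same_block J i j" "1 \<le> i \<and> i < j \<and> j \<le> n"
      using diff that by blast
    ultimately show ?thesis by (auto simp: Inv_iff_perms[OF y])
  qed
qed

text \<open>Puts global descents into the language of blocks: every pair separated by a cut must be
  inverted.\<close>

lemma subset_GDes_iff:
  assumes "v \<in> perms n"
  shows "J \<subseteq> GDes v \<longleftrightarrow> J \<subseteq> {1..<n} \<and>
    (\<forall>i j. 1 \<le> i \<and> i < j \<and> j \<le> n \<and> \<not> same_block J i j \<longrightarrow> (i, j) \<in> Inv v)"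
proof
  assume J: "J \<subseteq> GDes v"
  have "(i, j) \<in> Inv v" if ij: "1 \<le> i" "i < j" "j \<le> n" "\<not> same_block J i j" for i j
  proof -
    obtain p where "p \<in> J" "i \<le> p" "p < j" using ij by (auto simp: same_block_def)
    then show ?thesis using J ij perms_length[OF assms] by (auto simp: GDes_def Inv_iff_perms[OF assms])
  qed
  moreover have "J \<subseteq> {1..<n}" using J perms_length[OF assms] by (auto simp: GDes_def)
  ultimately show "J \<subseteq> {1..<n} \<and>
    (\<forall>i j. 1 \<le> i \<and> i < j \<and> j \<le> n \<and> \<not> same_block J i j \<longrightarrow> (i, j) \<in> Inv v)" by blast
next
  assume A: "J \<subseteq> {1..<n} \<and>
    (\<forall>i j. 1 \<le> i \<and> i < j \<and> j \<le> n \<and> \<not> same_block J i j \<longrightarrow> (i, j) \<in> Inv v)"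
  show "J \<subseteq> GDes v"
  proof
    fix p assume p: "p \<in> J"
    have "nth1 v j < nth1 v i" if "1 \<le> i" "i \<le> p" "p < j" "j \<le> n" for i j
    proof -
      have "\<not> same_block J i j" using p that by (auto simp: same_block_def)
      moreover have "i < j" using that by simp
      ultimately have "(i, j) \<in> Inv v" using A that by blast
      then show ?thesis by (simp add: Inv_iff_perms[OF assms])
    qed
    then show "p \<in> GDes v" using A p perms_length[OF assms] by (auto simp: GDes_def)
  qed
qed

lemma GDes_subset: "v \<in> perms n \<Longrightarrow> GDes v \<subseteq> {1..<n}"
  using subset_GDes_iff by blast

lemma finite_GDes: "finite (GDes v)"
  by (rule finite_subset[of _ "{1..<length v}"]) (auto simp: GDes_def)

lemma Inv_across_GDes:
  assumes "v \<in> perms n" "J \<subseteq> GDes v" "1 \<le> i" "i < j" "j \<le> n" "\<not> same_block J i j"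
  shows "(i, j) \<in> Inv v"
  using subset_GDes_iff[OF assms(1)] assms by blast

text \<open>Across blocks \<open>v\<close> already has every possible inversion, so
  \<open>v'\<close> could gain only inside blocks, where \<open>y\<close> bounds \<open>v'\<close>
  and agrees with \<open>v\<close>.\<close>

lemma eq_of_le_on_blocks_GDes:
  assumes v: "v \<in> perms n" and v': "v' \<in> perms n" and J: "J \<subseteq> GDes v"
    and sub: "Inv v \<subseteq> Inv v'" and le: "le_on_blocks J v' y" and agree: "agree_on_blocks J v y"
  shows "v' = v"
proof (rule perms_eq_of_Inv_eq[OF v' v])
  have "(i, j) \<in> Inv v" if ij: "(i, j) \<in> Inv v'" for i j
  proof (cases "same_block J i j")
    case True
    then show ?thesis using ij le agree unfolding le_on_blocks_def agree_on_blocks_def by blast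
  next
    case False
    then show ?thesis using Inv_across_GDes[OF v J] ij by (simp add: Inv_iff_perms[OF v'])
  qed
  then show "Inv v' = Inv v" using sub by auto
qed

text \<open>The witness has the inversions of \<open>y\<close> inside blocks and all inversions
  across them, so it contains every inversion set that \<open>y\<close> bounds on blocks.\<close>

lemma ex_agree_on_blocks:
  assumes y: "y \<in> perms n" and J: "J \<subseteq> {1..<n}"
  obtains v where "v \<in> perms n" "J \<subseteq> GDes v" "agree_on_blocks J v y"
    "\<forall>u\<in>perms n. le_on_blocks J u y \<longrightarrow> weak_le u v"
proof -
  obtain v where v: "v \<in> perms n"
    and I: "\<And>i j. (i, j) \<in> Inv v \<longleftrightarrow> 1 \<le> i \<and> i < j \<and> j \<le> n \<and> (same_block J i j \<longrightarrow> (i, j) \<in> Inv y)"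
    using ex_perm_with_global_descents[OF y finite_subset[OF J finite_atLeastLessThan]] by blast
  show ?thesis
  proof (rule that[OF v])
    show "J \<subseteq> GDes v" using I J unfolding subset_GDes_iff[OF v] by blast
    show "agree_on_blocks J v y" unfolding agree_on_blocks_def I by (auto simp: Inv_iff_perms[OF y])
    have "weak_le u v" if u: "u \<in> perms n" "le_on_blocks J u y" for u
    proof -
      have "(i, j) \<in> Inv v" if "(i, j) \<in> Inv u" for i j
        using that u(2) unfolding I le_on_blocks_def by (simp add: Inv_iff_perms[OF u(1)])
      then show ?thesis using v unfolding weak_le_iff[OF u(1)] by auto
    qed
    then show "\<forall>u\<in>perms n. le_on_blocks J u y \<longrightarrow> weak_le u v" by blast
  qed
qed

text \<open>Agreement on the blocks of \<open>GDes v\<close>, together with the inversions of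
  \<open>v\<close> across them, makes \<open>Inv y\<close> a subset of \<open>Inv v\<close>. So one
  half of the agreement on the coarser \<open>R\<close>-blocks always holds.\<close>

lemma le_on_blocks_iff_agree:
  assumes v: "v \<in> perms n" and y: "y \<in> perms n" and R: "R \<subseteq> GDes v"
    and agree: "agree_on_blocks (GDes v) v y"
  shows "le_on_blocks R v y \<longleftrightarrow> agree_on_blocks R v y"
proof
  assume le: "le_on_blocks R v y"
  have "(i, j) \<in> Inv v" if "(i, j) \<in> Inv y" for i j
  proof (cases "same_block (GDes v) i j")
    case True
    then show ?thesis using that agree unfolding agree_on_blocks_def by blast
  next
    case False
    then show ?thesis using that Inv_across_GDes[OF v subset_refl] by (simp add: Inv_iff_perms[OF y])
  qed
  then show "agree_on_blocks R v y" using le unfolding le_on_blocks_def agree_on_blocks_def by blast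
qed (auto simp: le_on_blocks_def agree_on_blocks_def)

section \<open>The sets \<open>C_set\<close> and alternating sums over cut sets\<close>

text \<open>Conditions (i) and (ii) collapse into agreement on blocks, and (iii) becomes minimality
  of \<open>GDes v\<close> among the cut sets above \<open>Des \<zeta>\<close> that give
  agreement.\<close>

lemma mem_C_set_GDes_iff:
  assumes v: "v \<in> perms n" and w: "w \<in> perms n" and \<zeta>: "\<zeta> \<in> perms n"
  defines "y \<equiv> compose w \<zeta>"
  shows "\<zeta> \<in> C_set (GDes v) v w \<longleftrightarrow> Des \<zeta> \<subseteq> GDes v \<and> weak_le (perm_inv \<zeta>) w \<and>
    agree_on_blocks (GDes v) v y \<and>
    (\<forall>R. Des \<zeta> \<subseteq> R \<and> R \<subseteq> GDes v \<and> agree_on_blocks R v y \<longrightarrow> R = GDes v)"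
proof -
  let ?G = "GDes v"
  have y: "y \<in> perms n" unfolding y_def by (rule compose_perms[OF w \<zeta>])
  have G: "?G \<subseteq> {1..<n}" by (rule GDes_subset[OF v])
  have iff: "weak_le (compose (parab v' R) (perm_inv \<zeta>)) w \<longleftrightarrow> weak_le (perm_inv \<zeta>) w \<and> le_on_blocks R v' y"
    if "v' \<in> perms n" "Des \<zeta> \<subseteq> R" "R \<subseteq> ?G" for v' R
    unfolding y_def using weak_le_parab_iff[OF that(1) w \<zeta>] that G by blast
  \<comment> \<open>The largest permutation below \<open>y\<close> on blocks lies above
    \<open>v\<close> and satisfies (i), so (ii) identifies it with \<open>v\<close>. Conversely,
    agreement leaves no room above \<open>v\<close>.\<close>
  have maximal: "le_on_blocks ?G v y \<and> (\<forall>v'\<in>perms n. weak_le v v' \<and> le_on_blocks ?G v' y \<longrightarrow> v' = v)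
    \<longleftrightarrow> agree_on_blocks ?G v y" (is "?L \<longleftrightarrow> _")
  proof
    assume L: ?L
    obtain x where x: "x \<in> perms n" "?G \<subseteq> GDes x" "agree_on_blocks ?G x y"
      "\<forall>u\<in>perms n. le_on_blocks ?G u y \<longrightarrow> weak_le u x"
      by (rule ex_agree_on_blocks[OF y G])
    have "le_on_blocks ?G x y" using x(3) by (auto simp: le_on_blocks_def agree_on_blocks_def)
    then have "x = v" using L x(1,4) v by blast
    then show "agree_on_blocks ?G v y" using x(3) by simp
  next
    assume a: "agree_on_blocks ?G v y"
    then have "le_on_blocks ?G v y" by (auto simp: le_on_blocks_def agree_on_blocks_def)
    moreover have "v' = v" if "v' \<in> perms n" "weak_le v v'" "le_on_blocks ?G v' y" for v'
      using eq_of_le_on_blocks_GDes[OF v that(1) subset_refl _ that(3) a] that(2)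
      unfolding weak_le_iff[OF v] by blast
    ultimately show ?L by blast
  qed
  show ?thesis
  proof (cases "Des \<zeta> \<subseteq> ?G \<and> weak_le (perm_inv \<zeta>) w")
    case True
    then have D: "Des \<zeta> \<subseteq> ?G" and B: "weak_le (perm_inv \<zeta>) w" by auto
    have "\<zeta> \<in> C_set ?G v w \<longleftrightarrow> le_on_blocks ?G v y \<and>
        (\<forall>v'\<in>perms n. weak_le v v' \<and> le_on_blocks ?G v' y \<longrightarrow> v' = v) \<and>
        (\<forall>R. Des \<zeta> \<subseteq> R \<and> R \<subseteq> ?G \<and> le_on_blocks R v y \<longrightarrow> R = ?G)"
    proof -
      have 1: "weak_le (compose (parab v' ?G) (perm_inv \<zeta>)) w \<longleftrightarrow> le_on_blocks ?G v' y"
        if "v' \<in> perms n" for v'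
        using iff[OF that D subset_refl] B by simp
      have 2: "weak_le (compose (parab v R) (perm_inv \<zeta>)) w \<longleftrightarrow> le_on_blocks R v y"
        if "Des \<zeta> \<subseteq> R" "R \<subseteq> ?G" for R
        using iff[OF v that] B by simp
      show ?thesis
        using \<zeta> D by (simp add: C_set_def perms_length[OF v] 1 1[OF v] 2 cong: conj_cong ball_cong)
    qed
    also have "\<dots> \<longleftrightarrow> agree_on_blocks ?G v y \<and>
        (\<forall>R. Des \<zeta> \<subseteq> R \<and> R \<subseteq> ?G \<and> le_on_blocks R v y \<longrightarrow> R = ?G)"
      unfolding maximal[symmetric] by simp
    also have "\<dots> \<longleftrightarrow> agree_on_blocks ?G v y \<and>
        (\<forall>R. Des \<zeta> \<subseteq> R \<and> R \<subseteq> ?G \<and> agree_on_blocks R v y \<longrightarrow> R = ?G)"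
      by (simp add: le_on_blocks_iff_agree[OF v y] cong: conj_cong)
    finally show ?thesis using D B by blast
  next
    case False
    then show ?thesis using iff[OF v _ subset_refl] by (auto simp: C_set_def)
  qed
qed

text \<open>If the ends differ, toggling an element of \<open>B\<close> outside \<open>A\<close>
  pairs the sets of the interval with opposite signs.\<close>

lemma sum_alternating_interval:
  assumes "finite B" "A \<subseteq> B"
  shows "(\<Sum>J | A \<subseteq> J \<and> J \<subseteq> B. (-1) ^ card J) = (of_bool (A = B) * (-1) ^ card B :: rat)"
proof (cases "A = B")
  case True
  then have "{J. A \<subseteq> J \<and> J \<subseteq> B} = {B}" by auto
  then show ?thesis using True by simp
next
  case False
  then obtain b where b: "b \<in> B" "b \<notin> A" using assms by auto
  let ?S = "{J. A \<subseteq> J \<and> J \<subseteq> B - {b}}"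
  have fin: "finite ?S" by (rule finite_subset[of _ "Pow B"]) (use assms in auto)
  have "{J. A \<subseteq> J \<and> J \<subseteq> B} = ?S \<union> insert b ` ?S"
  proof (intro subset_antisym subsetI)
    fix J assume J: "J \<in> {J. A \<subseteq> J \<and> J \<subseteq> B}"
    show "J \<in> ?S \<union> insert b ` ?S"
    proof (cases "b \<in> J")
      case True
      then have "J = insert b (J - {b})" "J - {b} \<in> ?S" using J b by auto
      then show ?thesis by blast
    qed (use J in auto)
  qed (use b in auto)
  then have "(\<Sum>J | A \<subseteq> J \<and> J \<subseteq> B. (-1) ^ card J) =
    (\<Sum>J\<in>?S. (-1) ^ card J) + (\<Sum>J\<in>insert b ` ?S. (-1) ^ card J :: rat)"
    using fin by (simp only:) (intro sum.union_disjoint, auto)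
  also have "(\<Sum>J\<in>insert b ` ?S. (-1) ^ card J) = (\<Sum>J\<in>?S. (-1) ^ card (insert b J) :: rat)"
  proof (subst sum.reindex)
    show "inj_on (insert b) ?S"
    proof (rule inj_onI)
      fix K L assume "K \<in> ?S" "L \<in> ?S" and e: "insert b K = insert b L"
      then have "b \<notin> K" "b \<notin> L" by auto
      then show "K = L" using e insert_ident by metis
    qed
  qed simp
  also have "\<dots> = (\<Sum>J\<in>?S. - ((-1) ^ card J))"
  proof (rule sum.cong[OF refl])
    fix J assume "J \<in> ?S"
    then have "finite J" "b \<notin> J" using assms(1) finite_subset by auto
    then show "(-1) ^ card (insert b J) = - ((-1) ^ card J :: rat)" by simp
  qed
  finally show ?thesis using False by (simp add: sum_negf)
qed

text \<open>Cuts that are removable one at a time are removable together. An inversion of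
  \<open>v\<close> crossing two global descents factors through a position between them into two
  shorter inversions of \<open>v\<close>; by induction these are inversions of \<open>y\<close>, and
  transitivity gives the long one. Crossing one global descent is the hypothesis on single removals,
  crossing none is agreement on the finest blocks.\<close>

lemma agree_on_blocks_remove:
  assumes v: "v \<in> perms n" and y: "y \<in> perms n" and J: "J \<subseteq> GDes v"
    and agree: "agree_on_blocks (GDes v) v y"
    and remove: "\<And>p. p \<in> GDes v \<Longrightarrow> p \<notin> J \<Longrightarrow> agree_on_blocks (GDes v - {p}) v y"
  shows "agree_on_blocks J v y"
proof -
  let ?G = "GDes v"
  have inv: "(i, j) \<in> Inv v" if "1 \<le> i" "j \<le> n" "p \<in> ?G" "i \<le> p" "p < j" for i j p
    using Inv_across_GDes[OF v subset_refl, of i j] that by (auto simp: same_block_def)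
  have "(i, j) \<in> Inv y" if "(i, j) \<in> Inv v" "same_block J i j" for i j
    using that
  proof (induction "j - i" arbitrary: i j rule: less_induct)
    case less
    then have ij: "1 \<le> i" "i < j" "j \<le> n" by (auto simp: Inv_iff_perms[OF v])
    show ?case
    proof (cases "\<exists>p\<in>?G. \<exists>q\<in>?G. i \<le> p \<and> p < q \<and> q < j")
      case True
      then obtain p q where pq: "p \<in> ?G" "q \<in> ?G" "i \<le> p" "p < q" "q < j" by blast
      \<comment> \<open>The first position after the cut \<open>p\<close>: it is separated from
        \<open>i\<close> by \<open>p\<close> and from \<open>j\<close> by \<open>q\<close>, so both
        shorter pairs are inversions of \<open>v\<close>.\<close>
      let ?k = "Suc p"
      have "(i, ?k) \<in> Inv v" "(?k, j) \<in> Inv v" using inv[of i ?k p] inv[of ?k j q] pq ij by auto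
      moreover have "same_block J i ?k" "same_block J ?k j"
        using less.prems(2) pq by (auto simp: same_block_def)
      ultimately have "(i, ?k) \<in> Inv y" "(?k, j) \<in> Inv y" using less.hyps[of ?k i] less.hyps[of j ?k] pq by auto
      then show ?thesis by (auto simp: Inv_iff_perms[OF y])
    next
      case False
      show ?thesis
      proof (cases "same_block ?G i j")
        case True
        then show ?thesis using agree less.prems(1) unfolding agree_on_blocks_def by blast
      next
        case no: False
        then obtain p where p: "p \<in> ?G" "i \<le> p" "p < j" by (auto simp: same_block_def)
        then have "p \<notin> J" using less.prems(2) by (auto simp: same_block_def)
        moreover have "same_block (?G - {p}) i j"
          unfolding same_block_def
        proof (intro ballI notI)
          fix q assume q: "q \<in> ?G - {p}" "i \<le> q \<and> q < j"
          then have "p < q \<or> q < p" by auto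
          then show False using False p q by blast
        qed
        ultimately show ?thesis using remove[OF p(1)] less.prems(1) unfolding agree_on_blocks_def by blast
      qed
    qed
  qed
  then have "le_on_blocks J v y" by (auto simp: le_on_blocks_def)
  then show ?thesis using le_on_blocks_iff_agree[OF v y J agree] by simp
qed

text \<open>Agreement passes to larger cut sets, and removable cuts can be removed together, so the
  \<open>J\<close> that count form an interval with top \<open>GDes v\<close> or do not exist. Its
  alternating sum survives only if the interval is one point, which is condition (iii).\<close>

lemma sum_alternating_agree:
  assumes v: "v \<in> perms n" and w: "w \<in> perms n" and \<zeta>: "\<zeta> \<in> perms n"
  shows "(\<Sum>J\<in>Pow (GDes v). (-1) ^ card J *
      of_bool (Des \<zeta> \<subseteq> J \<and> weak_le (perm_inv \<zeta>) w \<and> agree_on_blocks J v (compose w \<zeta>))) =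
    ((-1) ^ card (GDes v) * of_bool (\<zeta> \<in> C_set (GDes v) v w) :: rat)"
proof -
  let ?G = "GDes v" and ?y = "compose w \<zeta>"
  let ?K = "\<lambda>J. Des \<zeta> \<subseteq> J \<and> weak_le (perm_inv \<zeta>) w \<and> agree_on_blocks J v ?y"
  have y: "?y \<in> perms n" by (rule compose_perms[OF w \<zeta>])
  have "(\<Sum>J\<in>Pow ?G. (-1) ^ card J * of_bool (?K J)) = (\<Sum>J | ?K J \<and> J \<subseteq> ?G. (-1) ^ card J :: rat)"
    by (rule sum.mono_neutral_cong_right) (use finite_GDes in auto)
  also have "\<dots> = (-1) ^ card ?G * of_bool (\<zeta> \<in> C_set ?G v w)"
  proof (cases "?K ?G")
    case True
    \<comment> \<open>The bottom of the interval: besides \<open>Des \<zeta>\<close> it contains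
      every global descent whose removal alone destroys agreement.\<close>
    let ?A = "Des \<zeta> \<union> {p \<in> ?G. \<not> agree_on_blocks (?G - {p}) v ?y}"
    have "?K J \<longleftrightarrow> ?A \<subseteq> J" if J: "J \<subseteq> ?G" for J
    proof
      assume K: "?K J"
      have "agree_on_blocks (?G - {p}) v ?y" if "p \<notin> J" for p
        by (rule agree_on_blocks_mono[of J]) (use J that K in auto)
      then show "?A \<subseteq> J" using K by blast
    next
      assume A: "?A \<subseteq> J"
      have "agree_on_blocks J v ?y"
        by (rule agree_on_blocks_remove[OF v y J]) (use True A in auto)
      then show "?K J" using True A by blast
    qed
    note K = this
    have sub: "?A \<subseteq> ?G" using True by blast
    have "{J. ?K J \<and> J \<subseteq> ?G} = {J. ?A \<subseteq> J \<and> J \<subseteq> ?G}" using K by blast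
    then have "(\<Sum>J | ?K J \<and> J \<subseteq> ?G. (-1) ^ card J :: rat) = of_bool (?A = ?G) * (-1) ^ card ?G"
      using sum_alternating_interval[OF finite_GDes sub] by simp
    moreover have "\<zeta> \<in> C_set ?G v w \<longleftrightarrow> ?A = ?G"
    proof -
      have "\<zeta> \<in> C_set ?G v w \<longleftrightarrow> (\<forall>R. R \<subseteq> ?G \<and> ?K R \<longrightarrow> R = ?G)"
        unfolding mem_C_set_GDes_iff[OF v w \<zeta>] using True by blast
      also have "\<dots> \<longleftrightarrow> (\<forall>R. R \<subseteq> ?G \<and> ?A \<subseteq> R \<longrightarrow> R = ?G)" using K by blast
      also have "\<dots> \<longleftrightarrow> ?A = ?G" using sub by blast
      finally show ?thesis .
    qed
    ultimately show ?thesis by simp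
  next
    case False
    \<comment> \<open>If \<open>GDes v\<close> fails, every smaller cut set fails, because the
      conditions pass upwards.\<close>
    then have "{J. ?K J \<and> J \<subseteq> ?G} = {}" using agree_on_blocks_mono by blast
    moreover have "\<zeta> \<notin> C_set ?G v w" using False mem_C_set_GDes_iff[OF v w \<zeta>] by blast
    ultimately show ?thesis by (simp only: sum.empty) simp
  qed
  finally show ?thesis .
qed

section \<open>The antipode on the monomial basis\<close>

text \<open>For fixed \<open>J\<close> and \<zeta> only the largest permutation below
  \<open>compose w \<zeta>\<close> on blocks can contribute, and it lies above \<open>u\<close>
  exactly when \<open>u\<close> is itself below on blocks.\<close>

lemma sum_agree_above:
  assumes u: "u \<in> perms n" and w: "w \<in> perms n" and \<zeta>: "\<zeta> \<in> perms n" and J: "J \<subseteq> {1..<n}"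
  shows "(\<Sum>v\<in>perms n. of_bool (weak_le u v) * (of_bool (J \<subseteq> GDes v) *
      of_bool (Des \<zeta> \<subseteq> J \<and> weak_le (perm_inv \<zeta>) w \<and> agree_on_blocks J v (compose w \<zeta>)))) =
    (of_bool (Des \<zeta> \<subseteq> J \<and> weak_le (compose (parab u J) (perm_inv \<zeta>)) w) :: rat)"
proof (cases "Des \<zeta> \<subseteq> J \<and> weak_le (perm_inv \<zeta>) w")
  case True
  let ?y = "compose w \<zeta>"
  have y: "?y \<in> perms n" by (rule compose_perms[OF w \<zeta>])
  obtain x where x: "x \<in> perms n" "J \<subseteq> GDes x" "agree_on_blocks J x ?y"
    "\<forall>u\<in>perms n. le_on_blocks J u ?y \<longrightarrow> weak_le u x"
    by (rule ex_agree_on_blocks[OF y J])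
  \<comment> \<open>Maximality gives \<open>v\<close> below \<open>x\<close>, and a permutation
    agreeing on blocks with these global descents has nothing above it that is still bounded on
    blocks.\<close>
  have unique: "v = x" if v: "v \<in> perms n" "J \<subseteq> GDes v" "agree_on_blocks J v ?y" for v
  proof -
    have "le_on_blocks J v ?y" using v(3) by (auto simp: le_on_blocks_def agree_on_blocks_def)
    then have "Inv v \<subseteq> Inv x" using x(4) v(1) by (auto simp: weak_le_def)
    moreover have "le_on_blocks J x ?y" using x(3) by (auto simp: le_on_blocks_def agree_on_blocks_def)
    ultimately show ?thesis using eq_of_le_on_blocks_GDes[OF v(1) x(1) v(2) _ _ v(3)] by simp
  qed
  have le: "weak_le u x \<longleftrightarrow> le_on_blocks J u ?y"
  proof
    assume "weak_le u x"
    then have "Inv u \<subseteq> Inv x" by (simp add: weak_le_def)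
    then show "le_on_blocks J u ?y" using x(3) by (auto simp: le_on_blocks_def agree_on_blocks_def)
  qed (use x(4) u in blast)
  have "(\<Sum>v\<in>perms n. of_bool (weak_le u v) * (of_bool (J \<subseteq> GDes v) *
      of_bool (Des \<zeta> \<subseteq> J \<and> weak_le (perm_inv \<zeta>) w \<and> agree_on_blocks J v ?y))) =
    (\<Sum>v\<in>perms n. if v = x then of_bool (weak_le u x) else (0 :: rat))"
  proof (rule sum.cong[OF refl])
    fix v assume v: "v \<in> perms n"
    show "of_bool (weak_le u v) * (of_bool (J \<subseteq> GDes v) *
        of_bool (Des \<zeta> \<subseteq> J \<and> weak_le (perm_inv \<zeta>) w \<and> agree_on_blocks J v ?y)) =
      (if v = x then of_bool (weak_le u x) else (0 :: rat))"
      using unique[OF v] x(2,3) True by (cases "v = x") auto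
  qed
  also have "\<dots> = of_bool (weak_le u x)" using x(1) finite_perms[of n] by simp
  also have "\<dots> = of_bool (Des \<zeta> \<subseteq> J \<and> weak_le (compose (parab u J) (perm_inv \<zeta>)) w)"
    using True weak_le_parab_iff[OF u w \<zeta> J] le by simp
  finally show ?thesis .
next
  case False
  then have "\<not> (Des \<zeta> \<subseteq> J \<and> weak_le (compose (parab u J) (perm_inv \<zeta>)) w)"
    using weak_le_parab_iff[OF u w \<zeta> J] by blast
  moreover have "(Des \<zeta> \<subseteq> J \<and> weak_le (perm_inv \<zeta>) w \<and> P) = False" for P using False by blast
  ultimately show ?thesis by (simp only: of_bool_eq mult_zero_right sum.neutral_const)
qed

text \<open>Each signed \<open>kappa\<close> is expanded into an alternating sum over cut sets; then
  the sum over \<open>v\<close> is carried out first, for fixed \<open>J\<close> and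
  \<zeta>.\<close>

lemma sum_kappa_above:
  assumes u: "u \<in> perms n" and w: "w \<in> perms n"
  shows "(\<Sum>v\<in>perms n. of_bool (weak_le u v) * ((-1) ^ card (GDes v) * of_nat (kappa v w))) =
    (\<Sum>J\<in>Pow {1..<n}. (-1) ^ card J * of_nat (card {\<zeta> \<in> perms n. Des \<zeta> \<subseteq> J \<and>
      weak_le (compose (parab u J) (perm_inv \<zeta>)) w}) :: rat)"
proof -
  let ?K = "\<lambda>v \<zeta> J. Des \<zeta> \<subseteq> J \<and> weak_le (perm_inv \<zeta>) w \<and> agree_on_blocks J v (compose w \<zeta>)"
  have card: "of_nat (card {\<zeta> \<in> perms n. P \<zeta>}) = (\<Sum>\<zeta>\<in>perms n. of_bool (P \<zeta>) :: rat)" for P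
    using finite_perms[of n] by (simp add: sum_of_bool_eq Int_def)
  have expand: "(-1) ^ card (GDes v) * of_nat (kappa v w) =
    (\<Sum>\<zeta>\<in>perms n. \<Sum>J\<in>Pow {1..<n}. (-1) ^ card J * (of_bool (J \<subseteq> GDes v) * of_bool (?K v \<zeta> J)) :: rat)"
    if v: "v \<in> perms n" for v
  proof -
    have "C_set (GDes v) v w = {\<zeta> \<in> perms n. \<zeta> \<in> C_set (GDes v) v w}"
      by (auto simp: C_set_def perms_length[OF v])
    then have "(-1) ^ card (GDes v) * of_nat (kappa v w) =
      (\<Sum>\<zeta>\<in>perms n. (-1) ^ card (GDes v) * of_bool (\<zeta> \<in> C_set (GDes v) v w) :: rat)"
      unfolding kappa_def sum_distrib_left[symmetric] by (metis card)
    also have "\<dots> = (\<Sum>\<zeta>\<in>perms n. \<Sum>J\<in>Pow (GDes v). (-1) ^ card J * of_bool (?K v \<zeta> J))"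
      by (rule sum.cong[OF refl]) (rule sum_alternating_agree[OF v w, symmetric])
    \<comment> \<open>The range of \<open>J\<close> is made independent of \<open>v\<close> by an
      indicator, so that the sums can be interchanged.\<close>
    also have "\<dots> = (\<Sum>\<zeta>\<in>perms n. \<Sum>J\<in>Pow {1..<n}.
      (-1) ^ card J * (of_bool (J \<subseteq> GDes v) * of_bool (?K v \<zeta> J)))"
    proof (rule sum.cong[OF refl])
      fix \<zeta>
      show "(\<Sum>J\<in>Pow (GDes v). (-1) ^ card J * of_bool (?K v \<zeta> J)) =
        (\<Sum>J\<in>Pow {1..<n}. (-1) ^ card J * (of_bool (J \<subseteq> GDes v) * of_bool (?K v \<zeta> J)) :: rat)"
        by (rule sum.mono_neutral_cong_left) (use GDes_subset[OF v] in auto)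
    qed
    finally show ?thesis .
  qed
  have "(\<Sum>v\<in>perms n. of_bool (weak_le u v) * ((-1) ^ card (GDes v) * of_nat (kappa v w))) =
    (\<Sum>v\<in>perms n. \<Sum>\<zeta>\<in>perms n. \<Sum>J\<in>Pow {1..<n}. (-1) ^ card J *
      (of_bool (weak_le u v) * (of_bool (J \<subseteq> GDes v) * of_bool (?K v \<zeta> J))) :: rat)"
    by (rule sum.cong[OF refl]) (simp only: expand sum_distrib_left mult.left_commute)
  also have "\<dots> = (\<Sum>\<zeta>\<in>perms n. \<Sum>v\<in>perms n. \<Sum>J\<in>Pow {1..<n}. (-1) ^ card J *
      (of_bool (weak_le u v) * (of_bool (J \<subseteq> GDes v) * of_bool (?K v \<zeta> J))))"
    by (rule sum.swap)
  also have "\<dots> = (\<Sum>\<zeta>\<in>perms n. \<Sum>J\<in>Pow {1..<n}. (-1) ^ card J * (\<Sum>v\<in>perms n.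
      of_bool (weak_le u v) * (of_bool (J \<subseteq> GDes v) * of_bool (?K v \<zeta> J))))"
    unfolding sum_distrib_left by (rule sum.cong[OF refl]) (rule sum.swap)
  also have "\<dots> = (\<Sum>\<zeta>\<in>perms n. \<Sum>J\<in>Pow {1..<n}. (-1) ^ card J *
      of_bool (Des \<zeta> \<subseteq> J \<and> weak_le (compose (parab u J) (perm_inv \<zeta>)) w))"
    by (intro sum.cong refl arg_cong2[where f = "(*)"] sum_agree_above[OF u w]) auto
  also have "\<dots> = (\<Sum>J\<in>Pow {1..<n}. (-1) ^ card J * of_nat (card {\<zeta> \<in> perms n. Des \<zeta> \<subseteq> J \<and>
      weak_le (compose (parab u J) (perm_inv \<zeta>)) w}))"
    unfolding card sum_distrib_left by (rule sum.swap)
  finally show ?thesis .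
qed

text \<open>The left side is the coefficient of \<open>M w\<close> in the antipode of
  \<open>F u\<close>, because \<open>F x\<close> is the sum of the \<open>M w\<close> with
  \<open>w\<close> above \<open>x\<close>. Takeuchi's formula gives the right side once the \<zeta>
  are grouped by the composite \<open>x\<close>.\<close>

lemma sum_antiF_below:
  assumes u: "u \<in> perms n" and n: "1 \<le> n" and w: "w \<in> perms n"
  shows "(\<Sum>x\<in>perms n. antiF u x * of_bool (weak_le x w)) =
    (\<Sum>J\<in>Pow {1..<n}. (-1) ^ (card J + 1) * of_nat (card {\<zeta> \<in> perms n. Des \<zeta> \<subseteq> J \<and>
      weak_le (compose (parab u J) (perm_inv \<zeta>)) w}) :: rat)"
proof -
  let ?N = "\<lambda>J x. {\<zeta> \<in> perms n. Des \<zeta> \<subseteq> J \<and> compose (parab u J) (perm_inv \<zeta>) = x}"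
  have "(\<Sum>x\<in>perms n. antiF u x * of_bool (weak_le x w)) =
    (\<Sum>x\<in>perms n. \<Sum>J\<in>Pow {1..<n}. (-1) ^ (card J + 1) * (of_nat (card (?N J x)) * of_bool (weak_le x w)))"
  proof (rule sum.cong[OF refl])
    fix x
    have "takeuchi_term n u x J = (-1) ^ (card J + 1) * of_nat (card (?N J x))" if "J \<in> Pow {1..<n}" for J
      using card_factorizations[OF parab_perms[OF u], of J J x] that by (simp add: takeuchi_term_def)
    then show "antiF u x * of_bool (weak_le x w) =
      (\<Sum>J\<in>Pow {1..<n}. (-1) ^ (card J + 1) * (of_nat (card (?N J x)) * of_bool (weak_le x w)))"
      unfolding antiF_eq_sum[OF u n] sum_distrib_right by (intro sum.cong) (simp_all add: mult.assoc)
  qed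
  also have "\<dots> = (\<Sum>J\<in>Pow {1..<n}. (-1) ^ (card J + 1) *
      (\<Sum>x\<in>perms n. of_nat (card (?N J x)) * of_bool (weak_le x w)))"
    unfolding sum_distrib_left by (rule sum.swap)
  also have "\<dots> = (\<Sum>J\<in>Pow {1..<n}. (-1) ^ (card J + 1) * of_nat (card {\<zeta> \<in> perms n. Des \<zeta> \<subseteq> J \<and>
      weak_le (compose (parab u J) (perm_inv \<zeta>)) w}))"
  proof (intro sum.cong refl arg_cong2[where f = "(*)"])
    fix J assume "J \<in> Pow {1..<n}"
    let ?A = "{\<zeta> \<in> perms n. Des \<zeta> \<subseteq> J}" and ?g = "\<lambda>\<zeta>. compose (parab u J) (perm_inv \<zeta>)"
    have fin: "finite ?A" using finite_perms by simp
    have "(\<Sum>x\<in>perms n. of_nat (card (?N J x)) * of_bool (weak_le x w)) =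
      (\<Sum>x\<in>perms n. \<Sum>\<zeta> | \<zeta> \<in> ?A \<and> ?g \<zeta> = x. of_bool (weak_le (?g \<zeta>) w) :: rat)"
      by (rule sum.cong[OF refl]) (simp add: conj_assoc)
    also have "\<dots> = (\<Sum>\<zeta>\<in>?A. of_bool (weak_le (?g \<zeta>) w))"
      by (rule sum.group[OF fin finite_perms])
        (use compose_perms[OF parab_perms[OF u] perm_inv_perms] \<open>J \<in> Pow {1..<n}\<close> in auto)
    also have "\<dots> = of_nat (card {\<zeta> \<in> perms n. Des \<zeta> \<subseteq> J \<and> weak_le (?g \<zeta>) w})"
    proof -
      have "?A \<inter> {\<zeta>. weak_le (?g \<zeta>) w} = {\<zeta> \<in> perms n. Des \<zeta> \<subseteq> J \<and> weak_le (?g \<zeta>) w}" by auto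
      then show ?thesis using fin by (simp add: sum_of_bool_eq)
    qed
    finally show "(\<Sum>x\<in>perms n. of_nat (card (?N J x)) * of_bool (weak_le x w)) =
      (of_nat (card {\<zeta> \<in> perms n. Des \<zeta> \<subseteq> J \<and> weak_le (?g \<zeta>) w}) :: rat)" .
  qed
  finally show ?thesis .
qed

lemma antiF_eq_0: "u \<in> perms n \<Longrightarrow> 1 \<le> n \<Longrightarrow> x \<notin> perms n \<Longrightarrow> antiF u x = 0"
  by (simp add: antiF_eq_sum takeuchi_term_def)

text \<open>Since \<open>F u\<close> is the sum of the \<open>M v\<close> with \<open>v\<close>
  above \<open>u\<close>, this is the claimed formula summed over those \<open>v\<close>. Both sides
  have the same coefficients at each \<open>M w\<close> by the two preceding sums.\<close>

lemma antiF_eq_sum_M: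
  assumes u: "u \<in> perms n" and n: "1 \<le> n"
  shows "antiF u x = (\<Sum>v\<in>perms n. of_bool (weak_le u v) *
    ((-1) ^ (card (GDes v) + 1) * (\<Sum>w\<in>perms n. of_nat (kappa v w) * M w x)))"
proof -
  have "(\<Sum>v\<in>perms n. of_bool (weak_le u v) *
    ((-1) ^ (card (GDes v) + 1) * (\<Sum>w\<in>perms n. of_nat (kappa v w) * M w x))) =
    (\<Sum>v\<in>perms n. \<Sum>w\<in>perms n. - (of_bool (weak_le u v) * ((-1) ^ card (GDes v) * of_nat (kappa v w))) * M w x)"
    by (simp add: sum_distrib_left sum_negf mult.assoc)
  also have "\<dots> = (\<Sum>w\<in>perms n. - (\<Sum>v\<in>perms n. of_bool (weak_le u v) *
      ((-1) ^ card (GDes v) * of_nat (kappa v w))) * M w x)"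
    by (subst sum.swap) (simp only: sum_distrib_right sum_negf[symmetric])
  also have "\<dots> = (\<Sum>w\<in>perms n. (\<Sum>z\<in>perms n. antiF u z * of_bool (weak_le z w)) * M w x)"
    by (rule sum.cong[OF refl]) (simp add: sum_kappa_above[OF u] sum_antiF_below[OF u n] sum_negf)
  \<comment> \<open>The inner sum is the zeta function times \<open>mu\<close>, which leaves only
    \<open>z = x\<close>.\<close>
  also have "\<dots> = (\<Sum>z\<in>perms n. antiF u z * (\<Sum>w\<in>perms n. of_bool (weak_le z w) * mu w x))"
    unfolding sum_distrib_right sum_distrib_left M_eq_mu
    by (subst sum.swap) (simp only: mult.assoc)
  also have "\<dots> = antiF u x"
  proof (cases "x \<in> perms n")
    case True
    then have "(\<Sum>z\<in>perms n. antiF u z * (\<Sum>w\<in>perms n. of_bool (weak_le z w) * mu w x)) =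
      (\<Sum>z\<in>perms n. if z = x then antiF u x else 0)"
      by (intro sum.cong) (auto simp: sum_weak_le_mu)
    then show ?thesis using True finite_perms[of n] by simp
  next
    case False
    then have "mu w x = 0" if "w \<in> perms n" for w
      using that weak_le_perms mu_eq_0 by blast
    then show ?thesis using antiF_eq_0[OF u n False] by simp
  qed
  finally show ?thesis ..
qed

theorem mainTheorem9:
  fixes n :: nat and v :: "nat list"
  assumes "n \<ge> 1" and "v \<in> perms n"
  shows "antipode (M v) =
    (\<lambda>x. (-1) ^ (card (GDes v) + 1) * (\<Sum>w\<in>perms n. of_nat (kappa v w) * M w x))"
proof
  fix x
  define T where "T v = (-1) ^ (card (GDes v) + 1) * (\<Sum>w\<in>perms n. of_nat (kappa v w) * M w x)" for v
  have sub: "supp (M v) \<subseteq> perms n"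
    using weak_le_perms[of v _ n] assms(2) by (auto simp: supp_def M_def split: if_splits)
  have "antipode (M v) x = (\<Sum>u\<in>supp (M v). M v u * antiF u x)"
    by (simp add: antipode_def)
  also have "\<dots> = (\<Sum>u\<in>perms n. mu v u * antiF u x)"
    by (rule sum.mono_neutral_cong_left[OF finite_perms sub]) (auto simp: supp_def M_eq_mu)
  \<comment> \<open>Each \<open>antiF u\<close> is a sum of \<open>T t\<close> over \<open>t\<close>
    above \<open>u\<close>, so summing against \<open>mu v\<close> inverts the relation and leaves
    \<open>t = v\<close>.\<close>
  also have "\<dots> = (\<Sum>u\<in>perms n. \<Sum>t\<in>perms n. mu v u * of_bool (weak_le u t) * T t)"
    by (rule sum.cong[OF refl]) (simp only: antiF_eq_sum_M[OF _ assms(1), of _ x, folded T_def] sum_distrib_left mult.assoc)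
  also have "\<dots> = (\<Sum>t\<in>perms n. (\<Sum>u\<in>perms n. mu v u * of_bool (weak_le u t)) * T t)"
    by (subst sum.swap) (simp only: sum_distrib_right)
  also have "\<dots> = (\<Sum>t\<in>perms n. if t = v then T v else 0)"
    by (rule sum.cong[OF refl]) (auto simp: sum_mu_weak_le[OF assms(2)])
  also have "\<dots> = T v" using assms(2) finite_perms[of n] by simp
  finally show "antipode (M v) x =
    (-1) ^ (card (GDes v) + 1) * (\<Sum>w\<in>perms n. of_nat (kappa v w) * M w x)"
    unfolding T_def .
qed

end
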